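(* Let $\{T_n; n\ge 1\}$ and $\{Y_n; n\ge 1\}$ be two sequences of non-negative negatively associated (NA) random variables, and suppose that the sequences $\{T_n;n\ge1\}$ and $\{Y_n;n\ge1\}$ are independent of each other. Suppose the $T_i$ have common continuous marginal distribution function $F$ with density $f$, and the $Y_i$ have common marginal distribution function $G$ with density $g=G'$. Assume that the kernel density $k$ has bounded variation on some finite interval $(r,s)$, with $k(t)=0$ for $t\notin(r,s)$, where $-\infty<r<0<s<\infty$. Suppose that $f$ and $g$ are bounded on the closed interval $[0,\tau]$ for some $\tau\in(a_F,\tau_L)$. Let $\{b_n;n\ge1\}$ be a sequence of positive bandwidths with $b_n\to0$ and $b_n^{-1}=o\big((n/\ln n)^{1/2}\big)$. Then $$\sup_{0<t\le\tau}\left|\tilde h_n(t)-h_n(t)-\frac{f_n^*(t)-E f_n^*(t)}{1-L(t)}\right|=O\big(b_n^{-1}(n^{-1}\ln n)^{1/2}\big)\quad\text{a.s.}$$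
   Context: Negative association: a finite family $T_1,\dots,T_n$ of random variables is NA if for every pair of disjoint subsets $B_1,B_2$ of $\{1,\dots,n\}$, $\operatorname{cov}(f_1(T_i;i\in B_1),f_2(T_j;j\in B_2))\le0$ whenever $f_1,f_2$ are both increasing in every variable (or both decreasing in every variable) and the covariance exists. An infinite sequence is NA if every finite subfamily is NA. Censored data: one observes $X_i=\min(T_i,Y_i)$ and $\delta_i=I(T_i\le Y_i)$, $i=1,\dots,n$, where $I(A)$ is the indicator of $A$. $L$ denotes the common distribution function of the $X_i$, so that $1-L=(1-F)(1-G)$. For a distribution function $D$, $a_D=\inf\{t:D(t)>0\}$ and $\tau_D=\sup\{t:D(t)<1\}$; in particular $\tau_L=\min(\tau_F,\tau_G)$. Hazard: the hazard function is $h(t)=f(t)/(1-F(t))$ for $F(t)<1$, and the cumulative hazard function is $H(t)=\int_0^t h(s)\,ds$. Empirical cumulative hazard estimator: let $N_n(t)=\sum_{i=1}^n I(X_i\le t,\delta_i=1)$ and $dN_n(t)=N_n(t)-N_n(t-)$. Then $$\hat H_n(x)=\sum_{t\le x}\frac{dN_n(t)}{\#\{i\le n:X_i\ge t\}},$$ the sum being over the finitely many $t\le x$ with $dN_n(t)>0$. In the absence of ties this is $\sum_{X_{(j)}\le x}\frac{\delta_{(j)}}{n-j+1}$, where $X_{(1)}\le\dots\le X_{(n)}$ are the order statistics of $X_1,\dots,X_n$ and $\delta_{(j)}$ is the censoring indicator associated with $X_{(j)}$. Kernel quantities: $k$ is a (smoothing) probability kernel function, i.e. a probability density on $\mathbb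 R$, and $$\tilde h_n(t)=b_n^{-1}\int_{a_F}^{+\infty}k\Big(\frac{t-x}{b_n}\Big)\,d\hat H_n(x),\qquad h_n(t)=b_n^{-1}\int_{a_F}^{+\infty}k\Big(\frac{t-x}{b_n}\Big)\,dH(x),$$ $$f_n^*(t)=b_n^{-1}\int_{a_F}^{+\infty}k\Big(\frac{t-x}{b_n}\Big)\,dF_{*n}(x),\qquad F_{*n}(x)=\frac1n\sum_{i=1}^n I(X_i\le x,\ \delta_i=1).$$ "$Z_n=O(a_n)$ a.s." means $\limsup_{n\to\infty}|Z_n|/a_n<\infty$ almost surely (so only large $n$ matter; since $k$ has bounded support and $b_n\to0$, for large $n$ the integrals for $t\le\tau$ only involve $x$ in a region where $H$ is finite). *)

theory Defs
  imports "HOL-Probability.Probability" "HOL-Library.Landau_Symbols"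
begin

section \<open>Negative association\<close>

definition cov :: "'a measure \<Rightarrow> ('a \<Rightarrow> real) \<Rightarrow> ('a \<Rightarrow> real) \<Rightarrow> real" where
  "cov M U V = (\<integral>\<omega>. (U \<omega> - (\<integral>\<omega>'. U \<omega>' \<partial>M)) * (V \<omega> - (\<integral>\<omega>'. V \<omega>' \<partial>M)) \<partial>M)"

definition cov_exists :: "'a measure \<Rightarrow> ('a \<Rightarrow> real) \<Rightarrow> ('a \<Rightarrow> real) \<Rightarrow> bool" where
  "cov_exists M U V \<longleftrightarrow>
     integrable M U \<and> integrable M V \<and> integrable M (\<lambda>\<omega>. U \<omega> * V \<omega>)"

text \<open>
  A function of the variables with index in \<open>B\<close> is modelled as a function on all families.
  Both predicates below force it to depend on the coordinates in \<open>B\<close> only (take families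
  that agree on \<open>B\<close> and compare in both directions).
\<close>

definition increasing_in :: "'i set \<Rightarrow> (('i \<Rightarrow> real) \<Rightarrow> real) \<Rightarrow> bool" where
  "increasing_in B \<phi> \<longleftrightarrow> (\<forall>x y. (\<forall>i\<in>B. x i \<le> y i) \<longrightarrow> \<phi> x \<le> \<phi> y)"

definition decreasing_in :: "'i set \<Rightarrow> (('i \<Rightarrow> real) \<Rightarrow> real) \<Rightarrow> bool" where
  "decreasing_in B \<phi> \<longleftrightarrow> (\<forall>x y. (\<forall>i\<in>B. x i \<le> y i) \<longrightarrow> \<phi> y \<le> \<phi> x)"

definition neg_assoc_finite :: "'a measure \<Rightarrow> 'i set \<Rightarrow> ('i \<Rightarrow> 'a \<Rightarrow> real) \<Rightarrow> bool" where
  "neg_assoc_finite M J T \<longleftrightarrow>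
     (\<forall>i\<in>J. T i \<in> borel_measurable M) \<and>
     (\<forall>B1 B2 \<phi>1 \<phi>2.
        B1 \<subseteq> J \<and> B2 \<subseteq> J \<and> B1 \<inter> B2 = {} \<and>
        (increasing_in B1 \<phi>1 \<and> increasing_in B2 \<phi>2 \<or>
         decreasing_in B1 \<phi>1 \<and> decreasing_in B2 \<phi>2) \<and>
        cov_exists M (\<lambda>\<omega>. \<phi>1 (\<lambda>i. T i \<omega>)) (\<lambda>\<omega>. \<phi>2 (\<lambda>i. T i \<omega>)) \<longrightarrow>
        cov M (\<lambda>\<omega>. \<phi>1 (\<lambda>i. T i \<omega>)) (\<lambda>\<omega>. \<phi>2 (\<lambda>i. T i \<omega>)) \<le> 0)"

definition neg_assoc :: "'a measure \<Rightarrow> 'i set \<Rightarrow> ('i \<Rightarrow> 'a \<Rightarrow> real) \<Rightarrow> bool" where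
  "neg_assoc M I T \<longleftrightarrow> (\<forall>J. finite J \<and> J \<subseteq> I \<longrightarrow> neg_assoc_finite M J T)"


section \<open>Distribution functions, hazard, bounded variation\<close>

text \<open>
  The lower endpoint is real-valued: the set is nonempty and bounded below when \<open>D\<close> is the
  distribution function of a non-negative random variable. The upper endpoint may be \<open>\<infinity>\<close>.
\<close>

definition lower_endpoint :: "(real \<Rightarrow> real) \<Rightarrow> real" where
  "lower_endpoint D = Inf {t. 0 < D t}"

definition upper_endpoint :: "(real \<Rightarrow> real) \<Rightarrow> ereal" where
  "upper_endpoint D = (SUP t\<in>{t. D t < 1}. ereal t)"

text \<open>Only meaningful where \<open>F t < 1\<close>; elsewhere the value is \<open>0\<close> by division by zero.\<close>

definition hazard :: "(real \<Rightarrow> real) \<Rightarrow> (real \<Rightarrow> real) \<Rightarrow> real \<Rightarrow> real" where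
  "hazard f F t = f t / (1 - F t)"

definition cum_hazard :: "(real \<Rightarrow> real) \<Rightarrow> (real \<Rightarrow> real) \<Rightarrow> real \<Rightarrow> real" where
  "cum_hazard f F t = (LBINT s:{0..t}. hazard f F s)"

text \<open>
  The measure \<open>dH\<close>, where \<open>H = cum_hazard f F\<close>. It is not given as \<open>interval_measure H\<close>,
  because \<open>H\<close> increases to \<open>\<infinity>\<close> at the upper endpoint of \<open>F\<close> and so need not be a real-valued
  distribution function on the whole line. Where \<open>F < 1\<close> it is the Lebesgue-Stieltjes measure
  of \<open>H\<close>: see lemma \<open>emeasure_hazard_measure\<close>.
\<close>

definition hazard_measure :: "(real \<Rightarrow> real) \<Rightarrow> (real \<Rightarrow> real) \<Rightarrow> real measure" where
  "hazard_measure f F = density lborel (\<lambda>x. ennreal (indicator {0..} x * hazard f F x))"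

lemma emeasure_hazard_measure:
  fixes f F :: "real \<Rightarrow> real"
  assumes f: "f \<in> borel_measurable borel" "\<And>x. 0 \<le> f x" "integrable lborel f"
    and F: "mono F" "F b < 1" and ab: "0 \<le> a" "a \<le> b"
  shows "emeasure (hazard_measure f F) {a<..b} = ennreal (cum_hazard f F b - cum_hazard f F a)"
proof -
  have [measurable]: "f \<in> borel_measurable borel" "F \<in> borel_measurable borel"
    using f F borel_measurable_mono by auto
  have [measurable]: "hazard f F \<in> borel_measurable borel"
    unfolding hazard_def[abs_def] by measurable
  have Fx: "F x \<le> F b" if "x \<le> b" for x
    using F that by (auto simp: mono_def)
  have nn: "0 \<le> hazard f F x" if "x \<le> b" for x
    using f(2)[of x] Fx[OF that] F(2) by (auto simp: hazard_def)
  have le: "hazard f F x \<le> f x / (1 - F b)" if "x \<le> b" for x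
    unfolding hazard_def using f(2)[of x] Fx[OF that] F(2) by (intro divide_left_mono) auto
  have int: "set_integrable lborel {0..b} (hazard f F)"
    unfolding set_integrable_def
    by (rule Bochner_Integration.integrable_bound[where f = "\<lambda>x. f x / (1 - F b)"])
      (use f F(2) le nn in \<open>auto simp: indicator_def\<close>)
  have int_a: "set_integrable lborel {0..a} (hazard f F)"
    and int_ab: "set_integrable lborel {a<..b} (hazard f F)"
    using ab by (auto intro: set_integrable_subset[OF int])
  have "cum_hazard f F b = cum_hazard f F a + (LBINT s:{a<..b}. hazard f F s)"
  proof -
    have "{0..b} = {0..a} \<union> {a<..b}" using ab by auto
    moreover have "{0..a} \<inter> {a<..b} = {}" by auto
    ultimately show ?thesis
      unfolding cum_hazard_def using set_integral_Un[OF _ int_a int_ab] by simp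
  qed
  moreover have "emeasure (hazard_measure f F) {a<..b} = ennreal (LBINT s:{a<..b}. hazard f F s)"
  proof -
    have "emeasure (hazard_measure f F) {a<..b} =
        (\<integral>\<^sup>+x. ennreal (indicator {0..} x * hazard f F x) * indicator {a<..b} x \<partial>lborel)"
      unfolding hazard_measure_def by (rule emeasure_density) auto
    also have "\<dots> = (\<integral>\<^sup>+x. ennreal (indicator {a<..b} x *\<^sub>R hazard f F x) \<partial>lborel)"
      using ab by (intro nn_integral_cong) (auto simp: indicator_def)
    also have "\<dots> = ennreal (LBINT s:{a<..b}. hazard f F s)"
      unfolding set_lebesgue_integral_def
      by (rule nn_integral_eq_integral)
        (use int_ab nn in \<open>auto simp: set_integrable_def indicator_def\<close>)
    finally show ?thesis .
  qed
  ultimately show ?thesis by simp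
qed

definition bounded_variation_on :: "real set \<Rightarrow> (real \<Rightarrow> real) \<Rightarrow> bool" where
  "bounded_variation_on S \<phi> \<longleftrightarrow>
     (\<exists>C. \<forall>N (x :: nat \<Rightarrow> real).
        (\<forall>j\<le>N. x j \<in> S) \<and> (\<forall>j<N. x j < x (Suc j)) \<longrightarrow>
        (\<Sum>j<N. \<bar>\<phi> (x (Suc j)) - \<phi> (x j)\<bar>) \<le> C)"

definition probability_kernel :: "(real \<Rightarrow> real) \<Rightarrow> bool" where
  "probability_kernel k \<longleftrightarrow> (\<forall>x. 0 \<le> k x) \<and> has_bochner_integral lborel k 1"


lemma step_function_Stieltjes:
  fixes c :: "'b \<Rightarrow> real" and p :: "'b \<Rightarrow> real"
  assumes "finite S" "\<And>t. t \<in> S \<Longrightarrow> 0 \<le> c t"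
  shows "mono (\<lambda>x. \<Sum>t\<in>S. if p t \<le> x then c t else 0)"
    and "continuous (at_right y) (\<lambda>x. \<Sum>t\<in>S. if p t \<le> x then c t else 0)"
proof -
  show "mono (\<lambda>x. \<Sum>t\<in>S. if p t \<le> x then c t else 0)"
    using assms by (auto intro!: monoI sum_mono)
  have "continuous (at_right y) (\<lambda>x. if p t \<le> x then c t else 0)" for t
  proof -
    have "\<forall>\<^sub>F x in at_right y. (if p t \<le> x then c t else 0) = (if p t \<le> y then c t else 0)"
    proof (cases "p t \<le> y")
      case True
      have "\<forall>\<^sub>F u in at_right y. y < u" by (simp add: eventually_at_filter)
      then show ?thesis by eventually_elim (use True in auto)
    next
      case False
      then have "y < p t" by simp
      show ?thesis
        by (rule eventually_mono[OF eventually_at_right_real[OF \<open>y < p t\<close>]]) (use False in auto)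
    qed
    then show ?thesis
      by (simp add: continuous_within tendsto_eventually)
  qed
  then show "continuous (at_right y) (\<lambda>x. \<Sum>t\<in>S. if p t \<le> x then c t else 0)"
    by (intro continuous_sum)
qed


section \<open>Right-censored data\<close>

context
  fixes T Y :: "nat \<Rightarrow> 'a \<Rightarrow> real"
begin

definition obs :: "nat \<Rightarrow> 'a \<Rightarrow> real" where
  "obs i \<omega> = min (T i \<omega>) (Y i \<omega>)"

definition uncensored :: "nat \<Rightarrow> 'a \<Rightarrow> bool" where
  "uncensored i \<omega> \<longleftrightarrow> T i \<omega> \<le> Y i \<omega>"

definition death_count :: "nat \<Rightarrow> 'a \<Rightarrow> real \<Rightarrow> real" where
  "death_count n \<omega> t = real (card {i\<in>{1..n}. obs i \<omega> \<le> t \<and> uncensored i \<omega>})"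

definition death_jump :: "nat \<Rightarrow> 'a \<Rightarrow> real \<Rightarrow> real" where
  "death_jump n \<omega> t = death_count n \<omega> t - Lim (at_left t) (death_count n \<omega>)"

definition at_risk :: "nat \<Rightarrow> 'a \<Rightarrow> real \<Rightarrow> nat" where
  "at_risk n \<omega> t = card {i\<in>{1..n}. t \<le> obs i \<omega>}"

definition cum_hazard_est :: "nat \<Rightarrow> 'a \<Rightarrow> real \<Rightarrow> real" where
  "cum_hazard_est n \<omega> x =
     (\<Sum>t\<in>{t. t \<le> x \<and> 0 < death_jump n \<omega> t}. death_jump n \<omega> t / real (at_risk n \<omega> t))"

definition sub_edf :: "nat \<Rightarrow> 'a \<Rightarrow> real \<Rightarrow> real" where
  "sub_edf n \<omega> x = death_count n \<omega> x / real n"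

lemma death_jump_eq:
  "death_jump n \<omega> t = real (card {i\<in>{1..n}. obs i \<omega> = t \<and> uncensored i \<omega>})"
proof -
  let ?P = "\<lambda>R. {i\<in>{1..n}. R (obs i \<omega>) \<and> uncensored i \<omega>}"
  have "\<forall>\<^sub>F u in at_left t. \<forall>i\<in>{1..n}. obs i \<omega> \<le> u \<longleftrightarrow> obs i \<omega> < t"
  proof (intro eventually_ball_finite ballI)
    fix i
    show "\<forall>\<^sub>F u in at_left t. obs i \<omega> \<le> u \<longleftrightarrow> obs i \<omega> < t"
    proof (cases "obs i \<omega> < t")
      case True
      show ?thesis
        by (rule eventually_mono[OF eventually_at_left_real[OF True]]) (use True in auto)
    next
      case False
      have "\<forall>\<^sub>F u in at_left t. u < t" by (simp add: eventually_at_filter)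
      then show ?thesis by eventually_elim (use False in auto)
    qed
  qed simp
  then have "\<forall>\<^sub>F u in at_left t. death_count n \<omega> u = real (card (?P (\<lambda>x. x < t)))"
  proof eventually_elim
    case (elim u)
    then have "?P (\<lambda>x. x \<le> u) = ?P (\<lambda>x. x < t)" by blast
    then show ?case by (simp add: death_count_def)
  qed
  then have "(death_count n \<omega> \<longlongrightarrow> real (card (?P (\<lambda>x. x < t)))) (at_left t)"
    by (rule tendsto_eventually)
  then have "Lim (at_left t) (death_count n \<omega>) = real (card (?P (\<lambda>x. x < t)))"
    by (intro tendsto_Lim) auto
  moreover have "card (?P (\<lambda>x. x \<le> t)) = card (?P (\<lambda>x. x < t)) + card (?P (\<lambda>x. x = t))"
  proof -
    have "?P (\<lambda>x. x \<le> t) = ?P (\<lambda>x. x < t) \<union> ?P (\<lambda>x. x = t)" by auto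
    moreover have "?P (\<lambda>x. x < t) \<inter> ?P (\<lambda>x. x = t) = {}" by auto
    ultimately show ?thesis by (simp add: card_Un_disjoint)
  qed
  ultimately show ?thesis
    by (simp add: death_jump_def death_count_def)
qed

lemma finite_death_jump: "finite {t. 0 < death_jump n \<omega> t}"
proof (rule finite_subset)
  show "{t. 0 < death_jump n \<omega> t} \<subseteq> (\<lambda>i. obs i \<omega>) ` {1..n}"
    by (auto simp: death_jump_eq card_gt_0_iff)
qed simp

text \<open>
  The estimators are non-decreasing and right-continuous, so \<open>interval_measure\<close> is their
  Lebesgue-Stieltjes measure.
\<close>

lemma cum_hazard_est_Stieltjes:
  shows "mono (cum_hazard_est n \<omega>)" "continuous (at_right y) (cum_hazard_est n \<omega>)"
proof -
  let ?S = "{t. 0 < death_jump n \<omega> t}"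
  let ?c = "\<lambda>t. death_jump n \<omega> t / real (at_risk n \<omega> t)"
  have eq: "cum_hazard_est n \<omega> = (\<lambda>x. \<Sum>t\<in>?S. if t \<le> x then ?c t else 0)"
  proof
    fix x
    have "{t. t \<le> x \<and> 0 < death_jump n \<omega> t} = ?S \<inter> {t. t \<le> x}" by auto
    then show "cum_hazard_est n \<omega> x = (\<Sum>t\<in>?S. if t \<le> x then ?c t else 0)"
      using finite_death_jump by (simp add: cum_hazard_est_def sum.If_cases)
  qed
  have nn: "\<And>t. t \<in> ?S \<Longrightarrow> 0 \<le> ?c t" by auto
  show "mono (cum_hazard_est n \<omega>)" "continuous (at_right y) (cum_hazard_est n \<omega>)"
    unfolding eq
    using step_function_Stieltjes[OF finite_death_jump nn, where p = "\<lambda>t. t"] by auto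
qed

lemma sub_edf_Stieltjes:
  shows "mono (sub_edf n \<omega>)" "continuous (at_right y) (sub_edf n \<omega>)"
proof -
  let ?S = "{i\<in>{1..n}. uncensored i \<omega>}"
  have eq: "sub_edf n \<omega> = (\<lambda>x. \<Sum>i\<in>?S. if obs i \<omega> \<le> x then 1 / real n else 0)"
  proof
    fix x
    have "{i\<in>{1..n}. obs i \<omega> \<le> x \<and> uncensored i \<omega>} = ?S \<inter> {i. obs i \<omega> \<le> x}" by auto
    then show "sub_edf n \<omega> x = (\<Sum>i\<in>?S. if obs i \<omega> \<le> x then 1 / real n else 0)"
      by (simp add: sub_edf_def death_count_def sum.If_cases)
  qed
  show "mono (sub_edf n \<omega>)" "continuous (at_right y) (sub_edf n \<omega>)"
    unfolding eq
    using step_function_Stieltjes[where S = ?S and c = "\<lambda>_. 1 / real n" and p = "\<lambda>i. obs i \<omega>"] by auto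
qed

end


section \<open>Kernel smoothing\<close>

definition kernel_smooth ::
  "(real \<Rightarrow> real) \<Rightarrow> real \<Rightarrow> real \<Rightarrow> real measure \<Rightarrow> real \<Rightarrow> real" where
  "kernel_smooth k h a \<mu> t = inverse h * (LINT x:{a..}|\<mu>. k ((t - x) / h))"

definition hazard_est ::
  "(nat \<Rightarrow> 'a \<Rightarrow> real) \<Rightarrow> (nat \<Rightarrow> 'a \<Rightarrow> real) \<Rightarrow> (real \<Rightarrow> real) \<Rightarrow> (real \<Rightarrow> real) \<Rightarrow> (nat \<Rightarrow> real)
     \<Rightarrow> nat \<Rightarrow> 'a \<Rightarrow> real \<Rightarrow> real" where
  "hazard_est T Y F k b n \<omega> t =
     kernel_smooth k (b n) (lower_endpoint F) (interval_measure (cum_hazard_est T Y n \<omega>)) t"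

definition smoothed_hazard ::
  "(real \<Rightarrow> real) \<Rightarrow> (real \<Rightarrow> real) \<Rightarrow> (real \<Rightarrow> real) \<Rightarrow> (nat \<Rightarrow> real) \<Rightarrow> nat \<Rightarrow> real \<Rightarrow> real" where
  "smoothed_hazard f F k b n t =
     kernel_smooth k (b n) (lower_endpoint F) (hazard_measure f F) t"

definition sub_density_est ::
  "(nat \<Rightarrow> 'a \<Rightarrow> real) \<Rightarrow> (nat \<Rightarrow> 'a \<Rightarrow> real) \<Rightarrow> (real \<Rightarrow> real) \<Rightarrow> (real \<Rightarrow> real) \<Rightarrow> (nat \<Rightarrow> real)
     \<Rightarrow> nat \<Rightarrow> 'a \<Rightarrow> real \<Rightarrow> real" where
  "sub_density_est T Y F k b n \<omega> t =
     kernel_smooth k (b n) (lower_endpoint F) (interval_measure (sub_edf T Y n \<omega>)) t"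

text \<open>
  \<open>Z n = O(a n)\<close> almost surely. The sequence \<open>Z\<close> is extended-real-valued so that it may be a
  supremum that is infinite for some \<open>n\<close>.
\<close>

definition bigo_as :: "'a measure \<Rightarrow> (nat \<Rightarrow> 'a \<Rightarrow> ereal) \<Rightarrow> (nat \<Rightarrow> real) \<Rightarrow> bool" where
  "bigo_as M Z a \<longleftrightarrow> (AE \<omega> in M. limsup (\<lambda>n. \<bar>Z n \<omega>\<bar> / ereal (a n)) < \<infinity>)"

end

theory Submission
  imports Defs
begin

text \<open>
  The bound has the size that the two kernel errors \<open>h~ - h\<close> and \<open>f* - E f*\<close> have separately: no
  cancellation between them is used. Smoothing with a kernel of bounded variation and bandwidth
  \<open>b\<close> costs a factor \<open>inverse b\<close> times the uniform distance of the distribution functions that are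
  smoothed. So the theorem reduces to the rate \<open>sqrt (ln n / n)\<close>, uniformly on a half-line
  \<open>{..c}\<close> with \<open>\<tau> < c\<close> and \<open>L c < 1\<close>, for the sub-distribution function of the uncensored
  observations and for the empirical cumulative hazard. The room between \<open>\<tau>\<close> and \<open>c\<close> is what a
  kernel centred at \<open>t \<le> \<tau>\<close> reaches to the right once the bandwidth is small.

  Probability. The indicators of \<open>T i \<le> x \<and> T i \<le> Y i\<close> and of \<open>min (T i) (Y i) < x\<close> are monotone
  in \<open>T i\<close> and monotone in \<open>Y i\<close>. Integrating first over one sequence and then over the other, and
  using negative association of each, bounds the moment generating function of a sum of such
  indicators by the product of the individual ones
  (\<open>neg_assoc_pair_expectation_prod_le\<close>). Hoeffding's lemma then gives the same exponential tail as
  for independent variables (\<open>neg_assoc_pair_tail\<close>). Since the averages are monotone in \<open>x\<close> and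
  their means are continuous, a grid of \<open>n + 1\<close> points and the Borel-Cantelli lemma give the rate
  uniformly in \<open>x\<close> (\<open>monotone_average_uniform_rate\<close>).

  From there on everything is deterministic. If two finite measures have distribution functions
  that differ by at most \<open>\<epsilon>\<close> on \<open>{..c}\<close>, then their integrals of a monotone function with values
  in \<open>[0, C]\<close> over an interval in \<open>{..c}\<close> differ by at most \<open>2 * C * \<epsilon>\<close>: integrate over the
  level sets, which are intervals (\<open>cdf_close_integral\<close>). This is used twice. With
  \<open>1 / ((1 - F) * (1 - G))\<close> as integrand it carries the rate from the sub-distribution function to
  the cumulative hazard, because the latter is the integral of that function against the former
  (\<open>cum_hazard_est_cdf_close\<close>). With the two monotone parts of the kernel as integrands it gives the
  smoothing bound (\<open>cdf_close_kernel_integral\<close>).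
\<close>

section \<open>Product moments of negatively associated pairs\<close>

text \<open>
  The members of the family go up together or down together. This is what makes their products
  over an index set again monotone, in the direction that negative association asks for.
\<close>

definition comonotone_family :: "('i \<Rightarrow> real \<Rightarrow> real) \<Rightarrow> bool" where
  "comonotone_family \<psi> \<longleftrightarrow> (\<forall>i. mono (\<psi> i)) \<or> (\<forall>i. antimono (\<psi> i))"

text \<open>
  The direction in \<open>t\<close> must not depend on \<open>y\<close>, nor the direction in \<open>y\<close> on \<open>t\<close>, but the two
  directions may differ: the indicator of \<open>t \<le> y\<close> falls in \<open>t\<close> and rises in \<open>y\<close>.
\<close>

definition coordinatewise_monotone :: "(real \<Rightarrow> real \<Rightarrow> real) \<Rightarrow> bool" where
  "coordinatewise_monotone \<phi> \<longleftrightarrow> comonotone_family \<phi> \<and> comonotone_family (\<lambda>y t. \<phi> t y)"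

lemma comonotone_family_compose:
  assumes "comonotone_family \<psi>" "mono h \<or> antimono h"
  shows "comonotone_family (\<lambda>i x. h (\<psi> i x))"
  using assms unfolding comonotone_family_def mono_def antimono_def by metis

text \<open>
  Brings both exponentials of a summand and the negated summand, needed for the lower tail,
  under the hypotheses of the product inequality.
\<close>

lemma coordinatewise_monotone_compose:
  assumes "coordinatewise_monotone \<phi>" "mono h \<or> antimono h"
  shows "coordinatewise_monotone (\<lambda>t y. h (\<phi> t y))"
  using comonotone_family_compose[of \<phi> h] comonotone_family_compose[of "\<lambda>y t. \<phi> t y" h] assms
  unfolding coordinatewise_monotone_def by simp

lemma comonotone_family_measurable:
  assumes "comonotone_family \<psi>"
  shows "\<psi> i \<in> borel_measurable borel"
proof -
  have "mono (\<psi> i) \<or> mono (\<lambda>x. - \<psi> i x)"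
    using assms by (auto simp: comonotone_family_def mono_def antimono_def)
  then show ?thesis
    using borel_measurable_mono[of "\<psi> i"] borel_measurable_mono[of "\<lambda>x. - \<psi> i x"]
    by (auto simp: borel_measurable_uminus_eq)
qed

lemma neg_assoc_measurable:
  assumes "neg_assoc M I X" "i \<in> I"
  shows "X i \<in> borel_measurable M"
  using assms(1)[unfolded neg_assoc_def, rule_format, of "{i}"] assms(2)
  by (auto simp: neg_assoc_finite_def)

lemma neg_assoc_pair_measurable:
  fixes \<phi> :: "real \<Rightarrow> real \<Rightarrow> real"
  assumes na: "neg_assoc M I T" "neg_assoc M I Y" and i: "i \<in> I"
    and meas: "(\<lambda>z. \<phi> (fst z) (snd z)) \<in> borel_measurable (borel \<Otimes>\<^sub>M borel)"
  shows "(\<lambda>\<omega>. \<phi> (T i \<omega>) (Y i \<omega>)) \<in> borel_measurable M"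
proof -
  note [measurable] = neg_assoc_measurable[OF na(1) i] neg_assoc_measurable[OF na(2) i]
  have "(\<lambda>\<omega>. (T i \<omega>, Y i \<omega>)) \<in> measurable M (borel \<Otimes>\<^sub>M borel)" by measurable
  from measurable_compose[OF this meas] show ?thesis by simp
qed

context prob_space
begin

lemma integrable_bounded_nonneg:
  fixes h :: "'a \<Rightarrow> real"
  assumes "h \<in> borel_measurable M" "\<And>\<omega>. 0 \<le> h \<omega>" "\<And>\<omega>. h \<omega> \<le> C"
  shows "integrable M h"
  by (rule integrable_const_bound[of _ C]) (use assms in auto)

lemma cov_eq:
  assumes [simp]: "integrable M U" "integrable M V" "integrable M (\<lambda>\<omega>. U \<omega> * V \<omega>)"
  shows "cov M U V = expectation (\<lambda>\<omega>. U \<omega> * V \<omega>) - expectation U * expectation V"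
proof -
  let ?u = "expectation U" and ?v = "expectation V"
  have "cov M U V = expectation (\<lambda>\<omega>. U \<omega> * V \<omega> - U \<omega> * ?v - ?u * V \<omega> + ?u * ?v)"
    unfolding cov_def by (intro Bochner_Integration.integral_cong) (auto simp: algebra_simps)
  also have "\<dots> = expectation (\<lambda>\<omega>. U \<omega> * V \<omega>) - ?u * ?v"
    by (simp add: prob_space)
  finally show ?thesis .
qed

text \<open>
  Split off one factor at a time: the factor and the product of the remaining ones are monotone
  in the same direction and depend on disjoint sets of coordinates, so their covariance is not
  positive.
\<close>

lemma neg_assoc_expectation_prod_le:
  fixes X :: "'i \<Rightarrow> 'a \<Rightarrow> real"
  assumes na: "neg_assoc M I X" and J: "finite J" "J \<subseteq> I"
    and mon: "comonotone_family \<psi>"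
    and bd: "\<And>i x. 0 \<le> \<psi> i x" "\<And>i x. \<psi> i x \<le> C"
  shows "expectation (\<lambda>\<omega>. \<Prod>i\<in>J. \<psi> i (X i \<omega>)) \<le> (\<Prod>i\<in>J. expectation (\<lambda>\<omega>. \<psi> i (X i \<omega>)))"
  using J
proof (induction J rule: finite_induct)
  case empty
  then show ?case by (simp add: prob_space)
next
  case (insert a J)
  have naJ: "neg_assoc_finite M (insert a J) X"
    using na insert by (auto simp: neg_assoc_def)
  have meas[measurable]: "X i \<in> borel_measurable M" if "i \<in> insert a J" for i
    using naJ that by (auto simp: neg_assoc_finite_def)
  note [measurable] = comonotone_family_measurable[OF mon]
  let ?\<phi>1 = "\<lambda>x. \<psi> a (x a)" and ?\<phi>2 = "\<lambda>x. \<Prod>i\<in>J. \<psi> i (x i)"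
  have dir: "increasing_in {a} ?\<phi>1 \<and> increasing_in J ?\<phi>2 \<or>
      decreasing_in {a} ?\<phi>1 \<and> decreasing_in J ?\<phi>2"
    using mon bd unfolding comonotone_family_def increasing_in_def decreasing_in_def
      mono_def antimono_def by (auto intro!: prod_mono)
  have m1: "(\<lambda>\<omega>. \<psi> a (X a \<omega>)) \<in> borel_measurable M"
    using meas[of a] by measurable
  have m2: "(\<lambda>\<omega>. \<Prod>i\<in>J. \<psi> i (X i \<omega>)) \<in> borel_measurable M"
    using meas by (intro borel_measurable_prod) auto
  have b2: "(\<Prod>i\<in>J. \<psi> i (X i \<omega>)) \<le> C ^ card J" for \<omega>
    using prod_mono[of J "\<lambda>i. \<psi> i (X i \<omega>)" "\<lambda>_. C"] bd by simp
  have p2: "0 \<le> (\<Prod>i\<in>J. \<psi> i (X i \<omega>))" for \<omega>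
    using bd by (intro prod_nonneg) auto
  have C: "0 \<le> C" using bd[of a 0] by linarith
  have int: "integrable M (\<lambda>\<omega>. \<psi> a (X a \<omega>))" "integrable M (\<lambda>\<omega>. \<Prod>i\<in>J. \<psi> i (X i \<omega>))"
    "integrable M (\<lambda>\<omega>. \<psi> a (X a \<omega>) * (\<Prod>i\<in>J. \<psi> i (X i \<omega>)))"
  proof -
    show "integrable M (\<lambda>\<omega>. \<psi> a (X a \<omega>))"
      by (rule integrable_bounded_nonneg[OF m1 bd])
    show "integrable M (\<lambda>\<omega>. \<Prod>i\<in>J. \<psi> i (X i \<omega>))"
      by (rule integrable_bounded_nonneg[OF m2 p2 b2])
    show "integrable M (\<lambda>\<omega>. \<psi> a (X a \<omega>) * (\<Prod>i\<in>J. \<psi> i (X i \<omega>)))"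
      by (rule integrable_bounded_nonneg[OF borel_measurable_times[OF m1 m2]])
         (auto intro!: mult_nonneg_nonneg mult_mono bd b2 p2 C)
  qed
  have "cov M (\<lambda>\<omega>. ?\<phi>1 (\<lambda>i. X i \<omega>)) (\<lambda>\<omega>. ?\<phi>2 (\<lambda>i. X i \<omega>)) \<le> 0"
  proof -
    have e: "cov_exists M (\<lambda>\<omega>. ?\<phi>1 (\<lambda>i. X i \<omega>)) (\<lambda>\<omega>. ?\<phi>2 (\<lambda>i. X i \<omega>))"
      using int by (simp add: cov_exists_def)
    have d: "{a} \<subseteq> insert a J" "J \<subseteq> insert a J" "{a} \<inter> J = {}"
      using insert by auto
    show ?thesis
      using naJ d dir e unfolding neg_assoc_finite_def by blast
  qed
  then have "expectation (\<lambda>\<omega>. \<psi> a (X a \<omega>) * (\<Prod>i\<in>J. \<psi> i (X i \<omega>)))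
      \<le> expectation (\<lambda>\<omega>. \<psi> a (X a \<omega>)) * expectation (\<lambda>\<omega>. \<Prod>i\<in>J. \<psi> i (X i \<omega>))"
    using cov_eq[OF int] by simp
  also have "\<dots> \<le> expectation (\<lambda>\<omega>. \<psi> a (X a \<omega>)) * (\<Prod>i\<in>J. expectation (\<lambda>\<omega>. \<psi> i (X i \<omega>)))"
    using insert bd by (intro mult_left_mono insert.IH integral_nonneg_AE) auto
  finally show ?case using insert by simp
qed

text \<open>
  By independence the joint law is the product of the marginal laws, so the two sequences may be
  run on separate copies of the sample space.
\<close>

lemma indep_var_decoupling:
  fixes h :: "('i \<Rightarrow> real) \<times> ('i \<Rightarrow> real) \<Rightarrow> real"
  assumes ind: "indep_var (PiM I (\<lambda>_. borel)) (\<lambda>\<omega>. \<lambda>i\<in>I. T i \<omega>) (PiM I (\<lambda>_. borel)) (\<lambda>\<omega>. \<lambda>i\<in>I. Y i \<omega>)"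
    and h[measurable]: "h \<in> borel_measurable (PiM I (\<lambda>_. borel) \<Otimes>\<^sub>M PiM I (\<lambda>_. borel))"
    and bd: "\<And>z. \<bar>h z\<bar> \<le> C"
  shows "expectation (\<lambda>\<omega>. h (\<lambda>i\<in>I. T i \<omega>, \<lambda>i\<in>I. Y i \<omega>))
    = expectation (\<lambda>\<omega>. expectation (\<lambda>\<omega>'. h (\<lambda>i\<in>I. T i \<omega>, \<lambda>i\<in>I. Y i \<omega>')))"
proof -
  let ?P = "PiM I (\<lambda>_. borel :: real measure)"
  let ?T = "\<lambda>\<omega>. \<lambda>i\<in>I. T i \<omega>" and ?Y = "\<lambda>\<omega>. \<lambda>i\<in>I. Y i \<omega>"
  have T[measurable]: "?T \<in> measurable M ?P" and Y[measurable]: "?Y \<in> measurable M ?P"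
    and eq: "distr M ?P ?T \<Otimes>\<^sub>M distr M ?P ?Y = distr M (?P \<Otimes>\<^sub>M ?P) (\<lambda>\<omega>. (?T \<omega>, ?Y \<omega>))"
    using ind unfolding indep_var_distribution_eq by auto
  interpret T: prob_space "distr M ?P ?T" by (rule prob_space_distr) fact
  interpret Y: prob_space "distr M ?P ?Y" by (rule prob_space_distr) fact
  interpret TY: pair_prob_space "distr M ?P ?T" "distr M ?P ?Y" ..
  have "expectation (\<lambda>\<omega>. h (?T \<omega>, ?Y \<omega>)) = integral\<^sup>L (distr M ?P ?T \<Otimes>\<^sub>M distr M ?P ?Y) h"
    unfolding eq by (subst integral_distr) auto
  also have "\<dots> = (\<integral>t. \<integral>y. h (t, y) \<partial>distr M ?P ?Y \<partial>distr M ?P ?T)"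
  proof (rule TY.integral_fst'[symmetric])
    show "integrable (distr M ?P ?T \<Otimes>\<^sub>M distr M ?P ?Y) h"
      by (rule TY.integrable_const_bound[of _ C]) (use bd in auto)
  qed
  also have "\<dots> = (\<integral>t. \<integral>\<omega>'. h (t, ?Y \<omega>') \<partial>M \<partial>distr M ?P ?T)"
    by (intro Bochner_Integration.integral_cong refl, subst integral_distr)
       (auto intro!: measurable_Pair2 simp: space_PiM)
  also have "\<dots> = expectation (\<lambda>\<omega>. expectation (\<lambda>\<omega>'. h (?T \<omega>, ?Y \<omega>')))"
    by (subst integral_distr) auto
  finally show ?thesis .
qed

lemma indep_var_decoupling_coordinate:
  fixes h :: "real \<Rightarrow> real \<Rightarrow> real"
  assumes ind: "indep_var (PiM I (\<lambda>_. borel)) (\<lambda>\<omega>. \<lambda>i\<in>I. T i \<omega>) (PiM I (\<lambda>_. borel)) (\<lambda>\<omega>. \<lambda>i\<in>I. Y i \<omega>)"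
    and i: "i \<in> I"
    and h[measurable]: "(\<lambda>z. h (fst z) (snd z)) \<in> borel_measurable (borel \<Otimes>\<^sub>M borel)"
    and bd: "\<And>t y. \<bar>h t y\<bar> \<le> C"
  shows "expectation (\<lambda>\<omega>. h (T i \<omega>) (Y i \<omega>))
    = expectation (\<lambda>\<omega>. expectation (\<lambda>\<omega>'. h (T i \<omega>) (Y i \<omega>')))"
proof -
  let ?h = "\<lambda>(t, y). h (t i) (y i)"
  have "?h \<in> borel_measurable (PiM I (\<lambda>_. borel) \<Otimes>\<^sub>M PiM I (\<lambda>_. borel))"
  proof -
    have "(\<lambda>z. (fst z i, snd z i)) \<in> measurable (PiM I (\<lambda>_. borel) \<Otimes>\<^sub>M PiM I (\<lambda>_. borel)) (borel \<Otimes>\<^sub>M borel)"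
      using i by measurable
    from measurable_compose[OF this h] show ?thesis by (simp add: case_prod_beta')
  qed
  from indep_var_decoupling[OF ind this, of C] bd show ?thesis
    using i by (auto simp: case_prod_beta')
qed

text \<open>
  For a frozen value of the first sequence, negative association of the second one bounds the
  inner expectation by a product of functions \<open>m i (T i \<omega>)\<close>. These partial expectations inherit the
  common direction of monotonicity in \<open>T\<close>, so negative association of the first sequence applies
  to them.
\<close>

lemma neg_assoc_pair_expectation_prod_le:
  fixes T Y :: "'i \<Rightarrow> 'a \<Rightarrow> real"
  assumes na: "neg_assoc M I T" "neg_assoc M I Y"
    and ind: "indep_var (PiM I (\<lambda>_. borel)) (\<lambda>\<omega>. \<lambda>i\<in>I. T i \<omega>) (PiM I (\<lambda>_. borel)) (\<lambda>\<omega>. \<lambda>i\<in>I. Y i \<omega>)"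
    and J: "finite J" "J \<subseteq> I"
    and mon: "coordinatewise_monotone \<phi>"
    and meas[measurable]: "(\<lambda>z. \<phi> (fst z) (snd z)) \<in> borel_measurable (borel \<Otimes>\<^sub>M borel)"
    and bd: "\<And>t y. 0 \<le> \<phi> t y" "\<And>t y. \<phi> t y \<le> C"
  shows "expectation (\<lambda>\<omega>. \<Prod>i\<in>J. \<phi> (T i \<omega>) (Y i \<omega>))
    \<le> (\<Prod>i\<in>J. expectation (\<lambda>\<omega>. \<phi> (T i \<omega>) (Y i \<omega>)))"
proof -
  have monT: "comonotone_family (\<lambda>y t. \<phi> t y)" and monY: "comonotone_family \<phi>"
    using mon by (auto simp: coordinatewise_monotone_def)
  have mT[measurable]: "T i \<in> borel_measurable M" and mY[measurable]: "Y i \<in> borel_measurable M"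
    if "i \<in> I" for i
    using neg_assoc_measurable[OF na(1) that] neg_assoc_measurable[OF na(2) that] by auto
  define m where "m i t = expectation (\<lambda>\<omega>'. \<phi> t (Y i \<omega>'))" for i t
  \<comment> \<open>Outside \<open>I\<close> the variable \<open>Y i\<close> need not be measurable; there the family is padded with zero,
    which is monotone in both directions.\<close>
  define m' where "m' i = (if i \<in> I then m i else (\<lambda>_. 0))" for i
  have C: "0 \<le> C" using bd[of 0 0] by linarith
  have intY: "integrable M (\<lambda>\<omega>'. \<phi> t (Y i \<omega>'))" if "i \<in> I" for i t
    using mY[OF that] comonotone_family_measurable[OF monY, of t] bd
    by (intro integrable_bounded_nonneg[where C = C]) auto
  have m_bd: "0 \<le> m' i t" "m' i t \<le> C" for i t
    using intY[of i t] bd C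
    by (auto simp: m'_def m_def intro!: integral_le_const integral_nonneg_AE)
  have m_mon: "comonotone_family m'"
    using monT intY unfolding comonotone_family_def m'_def m_def mono_def antimono_def
    by (auto intro!: integral_mono)
  have meas_prod: "(\<lambda>(t, y). \<Prod>i\<in>J. \<phi> (t i) (y i))
      \<in> borel_measurable (PiM I (\<lambda>_. borel) \<Otimes>\<^sub>M PiM I (\<lambda>_. borel))"
  proof -
    have "(\<lambda>z. (fst z i, snd z i)) \<in> measurable (PiM I (\<lambda>_. borel) \<Otimes>\<^sub>M PiM I (\<lambda>_. borel)) (borel \<Otimes>\<^sub>M borel)"
      if "i \<in> J" for i
    proof -
      have i: "i \<in> I" using J that by auto
      show ?thesis using i by measurable
    qed
    from measurable_compose[OF this meas] show ?thesis
      by (auto simp: case_prod_beta' intro!: borel_measurable_prod)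
  qed
  have prod_bd: "\<bar>\<Prod>i\<in>J. \<phi> (t i) (y i)\<bar> \<le> C ^ card J" for t y
    using prod_mono[of J "\<lambda>i. \<phi> (t i) (y i)" "\<lambda>_. C"] bd by (simp add: abs_prod)
  have "expectation (\<lambda>\<omega>. \<Prod>i\<in>J. \<phi> (T i \<omega>) (Y i \<omega>))
      = expectation (\<lambda>\<omega>. expectation (\<lambda>\<omega>'. \<Prod>i\<in>J. \<phi> (T i \<omega>) (Y i \<omega>')))"
  proof -
    have r: "(\<Prod>i\<in>J. \<phi> (if i \<in> I then a i else undefined) (if i \<in> I then b i else undefined))
        = (\<Prod>i\<in>J. \<phi> (a i) (b i))" for a b
      using J by (intro prod.cong) auto
    show ?thesis
      using indep_var_decoupling[OF ind meas_prod, of "C ^ card J"] prod_bd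
      by (simp add: case_prod_beta' r)
  qed
  also have "\<dots> \<le> expectation (\<lambda>\<omega>. \<Prod>i\<in>J. m' i (T i \<omega>))"
  proof (rule integral_mono)
    show int: "integrable M (\<lambda>\<omega>. \<Prod>i\<in>J. m' i (T i \<omega>))"
    proof (rule integrable_bounded_nonneg[where C = "C ^ card J"])
      show "(\<lambda>\<omega>. \<Prod>i\<in>J. m' i (T i \<omega>)) \<in> borel_measurable M"
        using J mT comonotone_family_measurable[OF m_mon]
        by (intro borel_measurable_prod) (auto intro: measurable_compose)
      show "(\<Prod>i\<in>J. m' i (T i \<omega>)) \<le> C ^ card J" for \<omega>
        using prod_mono[of J "\<lambda>i. m' i (T i \<omega>)" "\<lambda>_. C"] m_bd by simp
    qed (auto intro!: prod_nonneg m_bd)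
    have "expectation (\<lambda>\<omega>'. \<Prod>i\<in>J. \<phi> (T i \<omega>) (Y i \<omega>'))
        \<le> (\<Prod>i\<in>J. expectation (\<lambda>\<omega>'. \<phi> (T i \<omega>) (Y i \<omega>')))" for \<omega>
      using monY bd
      by (intro neg_assoc_expectation_prod_le[OF na(2) J, where C = C])
         (auto simp: comonotone_family_def)
    also have "(\<Prod>i\<in>J. expectation (\<lambda>\<omega>'. \<phi> (T i \<omega>) (Y i \<omega>'))) = (\<Prod>i\<in>J. m' i (T i \<omega>))" for \<omega>
      using J by (intro prod.cong) (auto simp: m'_def m_def)
    finally show le: "expectation (\<lambda>\<omega>'. \<Prod>i\<in>J. \<phi> (T i \<omega>) (Y i \<omega>')) \<le> (\<Prod>i\<in>J. m' i (T i \<omega>))" for \<omega> .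
    have nn: "0 \<le> expectation (\<lambda>\<omega>'. \<Prod>i\<in>J. \<phi> (T i \<omega>) (Y i \<omega>'))" for \<omega>
      using bd by (auto intro!: integral_nonneg_AE prod_nonneg)
    have "(\<lambda>(\<omega>, \<omega>'). \<Prod>i\<in>J. \<phi> (T i \<omega>) (Y i \<omega>')) \<in> borel_measurable (M \<Otimes>\<^sub>M M)"
    proof -
      have "(\<lambda>z. (T i (fst z), Y i (snd z))) \<in> measurable (M \<Otimes>\<^sub>M M) (borel \<Otimes>\<^sub>M borel)"
        if "i \<in> J" for i
      proof -
        have i: "i \<in> I" using J that by auto
        note [measurable] = mT[OF i] mY[OF i]
        show ?thesis by measurable
      qed
      from measurable_compose[OF this meas] show ?thesis
        by (auto simp: case_prod_beta' intro!: borel_measurable_prod)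
    qed
    then have "(\<lambda>\<omega>. expectation (\<lambda>\<omega>'. \<Prod>i\<in>J. \<phi> (T i \<omega>) (Y i \<omega>'))) \<in> borel_measurable M"
      by (intro borel_measurable_lebesgue_integral) auto
    then show "integrable M (\<lambda>\<omega>. expectation (\<lambda>\<omega>'. \<Prod>i\<in>J. \<phi> (T i \<omega>) (Y i \<omega>')))"
      by (rule Bochner_Integration.integrable_bound[OF int])
         (use le nn m_bd in \<open>auto intro!: AE_I2 simp: prod_nonneg\<close>)
  qed
  also have "\<dots> \<le> (\<Prod>i\<in>J. expectation (\<lambda>\<omega>. m' i (T i \<omega>)))"
    by (rule neg_assoc_expectation_prod_le[OF na(1) J m_mon]) (rule m_bd)+
  also have "\<dots> = (\<Prod>i\<in>J. expectation (\<lambda>\<omega>. \<phi> (T i \<omega>) (Y i \<omega>)))"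
  proof (intro prod.cong refl)
    fix i assume "i \<in> J"
    then have i: "i \<in> I" using J by auto
    show "expectation (\<lambda>\<omega>. m' i (T i \<omega>)) = expectation (\<lambda>\<omega>. \<phi> (T i \<omega>) (Y i \<omega>))"
      using indep_var_decoupling_coordinate[OF ind i meas, of C] bd i
      by (simp add: m'_def m_def)
  qed
  finally show ?thesis .
qed

section \<open>Exponential tails and uniform rates for monotone averages\<close>

text \<open>
  Only the moment generating function of the sum enters Chernoff's bound, and it is at most the
  product of the individual ones, each of which is controlled by Hoeffding's lemma.
\<close>

lemma neg_assoc_pair_upper_tail:
  fixes T Y :: "'i \<Rightarrow> 'a \<Rightarrow> real" and \<phi> :: "real \<Rightarrow> real \<Rightarrow> real" and a m \<epsilon> :: real
  assumes na: "neg_assoc M I T" "neg_assoc M I Y"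
    and ind: "indep_var (PiM I (\<lambda>_. borel)) (\<lambda>\<omega>. \<lambda>i\<in>I. T i \<omega>) (PiM I (\<lambda>_. borel)) (\<lambda>\<omega>. \<lambda>i\<in>I. Y i \<omega>)"
    and J: "finite J" "J \<subseteq> I"
    and mon: "coordinatewise_monotone \<phi>"
    and meas[measurable]: "(\<lambda>z. \<phi> (fst z) (snd z)) \<in> borel_measurable (borel \<Otimes>\<^sub>M borel)"
    and bd: "\<And>t y. a \<le> \<phi> t y" "\<And>t y. \<phi> t y \<le> a + 1"
    and m: "\<And>i. i \<in> J \<Longrightarrow> expectation (\<lambda>\<omega>. \<phi> (T i \<omega>) (Y i \<omega>)) = m"
    and \<epsilon>: "0 < \<epsilon>"
  shows "prob {\<omega>\<in>space M. real (card J) * (m + \<epsilon>) \<le> (\<Sum>i\<in>J. \<phi> (T i \<omega>) (Y i \<omega>))} \<le> exp (- 2 * real (card J) * \<epsilon>\<^sup>2)"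
proof -
  \<comment> \<open>The minimiser of \<open>l\<^sup>2 / 8 - l * \<epsilon>\<close>, the exponent per summand in the Chernoff bound.\<close>
  define l where "l = 4 * \<epsilon>"
  have l: "0 < l" using \<epsilon> by (simp add: l_def)
  let ?n = "real (card J)"
  let ?\<psi> = "\<lambda>t y. exp (l * \<phi> t y)"
  let ?S = "\<lambda>\<omega>. \<Sum>i\<in>J. \<phi> (T i \<omega>) (Y i \<omega>)"
  have meas_i[measurable]: "(\<lambda>\<omega>. \<phi> (T i \<omega>) (Y i \<omega>)) \<in> borel_measurable M" if "i \<in> J" for i
    using neg_assoc_pair_measurable[OF na _ meas] that J by auto
  have exp_eq: "exp (l * ?S \<omega>) = (\<Prod>i\<in>J. ?\<psi> (T i \<omega>) (Y i \<omega>))" for \<omega>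
    using J by (simp add: sum_distrib_left exp_sum)
  have \<psi>_le: "?\<psi> t y \<le> exp (l * (a + 1))" for t y
    using bd l by simp
  have "expectation (\<lambda>\<omega>. exp (l * ?S \<omega>)) \<le> (\<Prod>i\<in>J. expectation (\<lambda>\<omega>. ?\<psi> (T i \<omega>) (Y i \<omega>)))"
    unfolding exp_eq
  proof (rule neg_assoc_pair_expectation_prod_le[OF na ind J])
    show "coordinatewise_monotone ?\<psi>"
      by (rule coordinatewise_monotone_compose[OF mon]) (use l in \<open>auto simp: mono_def\<close>)
  qed (use \<psi>_le in auto)
  also have "\<dots> \<le> (\<Prod>i\<in>J. exp (l * m + l\<^sup>2 / 8))"
  proof (rule prod_mono, intro conjI)
    fix i assume i: "i \<in> J"
    let ?X = "\<lambda>\<omega>. \<phi> (T i \<omega>) (Y i \<omega>)"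
    interpret interval_bounded_random_variable M ?X a "a + 1"
      by unfold_locales (use i bd in \<open>auto intro: meas_i\<close>)
    have int: "integrable M (\<lambda>\<omega>. exp (l * ?X \<omega>))"
      by (rule integrable_const_bound[of _ "exp (l * (a + 1))"]) (use i \<psi>_le in auto)
    have "ennreal (expectation (\<lambda>\<omega>. exp (l * (?X \<omega> - m)))) = (\<integral>\<^sup>+\<omega>. exp (l * (?X \<omega> - m)) \<partial>M)"
    proof (rule nn_integral_eq_integral[symmetric])
      show "integrable M (\<lambda>\<omega>. exp (l * (?X \<omega> - m)))"
        using int by (simp add: right_diff_distrib exp_diff)
    qed simp
    also have "\<dots> \<le> ennreal (exp (l\<^sup>2 / 8))"
      using Hoeffdings_lemma_nn_integral[OF l] m[OF i] by simp
    finally have "expectation (\<lambda>\<omega>. exp (l * (?X \<omega> - m))) \<le> exp (l\<^sup>2 / 8)"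
      by simp
    moreover have "expectation (\<lambda>\<omega>. exp (l * ?X \<omega>)) = exp (l * m) * expectation (\<lambda>\<omega>. exp (l * (?X \<omega> - m)))"
      by (simp add: right_diff_distrib exp_diff)
    ultimately show "expectation (\<lambda>\<omega>. exp (l * ?X \<omega>)) \<le> exp (l * m + l\<^sup>2 / 8)"
      by (simp add: exp_add)
    show "0 \<le> expectation (\<lambda>\<omega>. exp (l * ?X \<omega>))"
      by (rule integral_nonneg_AE) auto
  qed
  also have "\<dots> = exp (?n * (l * m + l\<^sup>2 / 8))"
    by (simp add: exp_of_nat_mult)
  finally have mgf: "expectation (\<lambda>\<omega>. exp (l * ?S \<omega>)) \<le> exp (?n * (l * m + l\<^sup>2 / 8))" .
  have "integrable M (\<lambda>\<omega>. exp (l * ?S \<omega>))"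
  proof (rule integrable_const_bound[of _ "exp (l * (a + 1)) ^ card J"])
    have "(\<Prod>i\<in>J. ?\<psi> (T i \<omega>) (Y i \<omega>)) \<le> (\<Prod>i\<in>J. exp (l * (a + 1)))" for \<omega>
      by (rule prod_mono) (use \<psi>_le in auto)
    then show "AE \<omega> in M. norm (exp (l * ?S \<omega>)) \<le> exp (l * (a + 1)) ^ card J"
      by (simp add: exp_eq abs_prod)
  qed simp
  note int = this
  then have "set_integrable M (space M) (\<lambda>\<omega>. exp (l * ?S \<omega>))"
    unfolding set_integrable_def by (rule integrable_mult_indicator[OF sets.top])
  from Chernoff_ineq_ge[OF l this, of "?n * (m + \<epsilon>)"]
  have "prob {\<omega>\<in>space M. ?n * (m + \<epsilon>) \<le> ?S \<omega>}
      \<le> exp (- l * (?n * (m + \<epsilon>))) * expectation (\<lambda>\<omega>. exp (l * ?S \<omega>))"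
    by (simp add: set_integral_space[OF int])
  also have "\<dots> \<le> exp (- l * (?n * (m + \<epsilon>))) * exp (?n * (l * m + l\<^sup>2 / 8))"
    using mgf by simp
  also have "\<dots> = exp (- 2 * ?n * \<epsilon>\<^sup>2)"
    unfolding exp_add[symmetric] by (simp add: l_def power2_eq_square algebra_simps)
  finally show ?thesis .
qed

lemma neg_assoc_pair_tail:
  fixes T Y :: "'i \<Rightarrow> 'a \<Rightarrow> real" and \<phi> :: "real \<Rightarrow> real \<Rightarrow> real" and m \<epsilon> :: real
  assumes na: "neg_assoc M I T" "neg_assoc M I Y"
    and ind: "indep_var (PiM I (\<lambda>_. borel)) (\<lambda>\<omega>. \<lambda>i\<in>I. T i \<omega>) (PiM I (\<lambda>_. borel)) (\<lambda>\<omega>. \<lambda>i\<in>I. Y i \<omega>)"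
    and J: "finite J" "J \<subseteq> I" "J \<noteq> {}"
    and mon: "coordinatewise_monotone \<phi>"
    and meas[measurable]: "(\<lambda>z. \<phi> (fst z) (snd z)) \<in> borel_measurable (borel \<Otimes>\<^sub>M borel)"
    and bd: "\<And>t y. 0 \<le> \<phi> t y" "\<And>t y. \<phi> t y \<le> 1"
    and m: "\<And>i. i \<in> J \<Longrightarrow> expectation (\<lambda>\<omega>. \<phi> (T i \<omega>) (Y i \<omega>)) = m"
    and \<epsilon>: "0 < \<epsilon>"
  shows "prob {\<omega>\<in>space M. \<epsilon> \<le> \<bar>(\<Sum>i\<in>J. \<phi> (T i \<omega>) (Y i \<omega>)) / real (card J) - m\<bar>} \<le> 2 * exp (- 2 * real (card J) * \<epsilon>\<^sup>2)"
proof -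
  let ?n = "real (card J)"
  let ?S = "\<lambda>\<omega>. \<Sum>i\<in>J. \<phi> (T i \<omega>) (Y i \<omega>)"
  have n: "0 < ?n" using J by (simp add: card_gt_0_iff)
  have [measurable]: "(\<lambda>\<omega>. \<phi> (T i \<omega>) (Y i \<omega>)) \<in> borel_measurable M" if "i \<in> J" for i
    using neg_assoc_pair_measurable[OF na _ meas] that J by auto
  let ?U = "{\<omega>\<in>space M. ?n * (m + \<epsilon>) \<le> ?S \<omega>}"
  let ?L = "{\<omega>\<in>space M. ?n * (- m + \<epsilon>) \<le> (\<Sum>i\<in>J. - \<phi> (T i \<omega>) (Y i \<omega>))}"
  have "{\<omega>\<in>space M. \<epsilon> \<le> \<bar>?S \<omega> / ?n - m\<bar>} \<subseteq> ?U \<union> ?L"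
    using n by (auto simp: abs_if field_simps sum_negf split: if_splits)
  then have "prob {\<omega>\<in>space M. \<epsilon> \<le> \<bar>?S \<omega> / ?n - m\<bar>} \<le> prob (?U \<union> ?L)"
    by (intro finite_measure_mono) auto
  also have "\<dots> \<le> prob ?U + prob ?L"
    by (rule measure_Un_le) auto
  also have "prob ?U \<le> exp (- 2 * ?n * \<epsilon>\<^sup>2)"
    by (rule neg_assoc_pair_upper_tail[OF na ind J(1,2) mon meas, where a = 0]) (use bd m \<epsilon> in auto)
  also have "prob ?L \<le> exp (- 2 * ?n * \<epsilon>\<^sup>2)"
  proof (rule neg_assoc_pair_upper_tail[OF na ind J(1,2), where a = "-1"])
    show "coordinatewise_monotone (\<lambda>t y. - \<phi> t y)"
      by (rule coordinatewise_monotone_compose[OF mon]) (auto simp: antimono_def)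
  qed (use bd m \<epsilon> in auto)
  finally show ?thesis by simp
qed

text \<open>
  Choose \<open>n + 1\<close> grid points at which \<open>m\<close> grows in equal steps. By monotonicity the deviation between
  two neighbours exceeds the larger of theirs by at most one step, of size \<open>(m c - m a) / n\<close>, which is
  of smaller order than \<open>sqrt (ln n / n)\<close>. The deviations on the grid are controlled by the tail
  bound and the Borel-Cantelli lemma.
\<close>

lemma monotone_average_uniform_rate:
  fixes Z :: "nat \<Rightarrow> real \<Rightarrow> 'a \<Rightarrow> real" and m :: "real \<Rightarrow> real"
  assumes ac: "a \<le> c"
    and meas[measurable]: "\<And>n x. Z n x \<in> borel_measurable M"
    and mono: "\<And>n \<omega> x y. x \<le> y \<Longrightarrow> Z n x \<omega> \<le> Z n y \<omega>"
    and cont: "continuous_on {a..c} m" and m_mono: "mono m"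
    and tail: "\<And>n x \<epsilon>. 1 \<le> n \<Longrightarrow> 0 < \<epsilon> \<Longrightarrow>
      prob {\<omega>\<in>space M. \<epsilon> \<le> \<bar>Z n x \<omega> - m x\<bar>} \<le> 2 * exp (- 2 * real n * \<epsilon>\<^sup>2)"
  shows "\<exists>K. 0 \<le> K \<and> (AE \<omega> in M. \<forall>\<^sub>F n in sequentially.
    \<forall>x\<in>{a..c}. \<bar>Z n x \<omega> - m x\<bar> \<le> K * sqrt (ln (real n) / real n))"
proof -
  define D where "D = m c - m a"
  have D: "0 \<le> D" using m_mono ac by (simp add: D_def mono_def)
  have "\<exists>x. x \<in> {a..c} \<and> (j = 0 \<longrightarrow> x = a) \<and> (j = n \<longrightarrow> x = c) \<and> m x = m a + real j / real n * D"
    if "1 \<le> n" "j \<le> n" for j n :: nat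
  proof -
    have "\<exists>x\<ge>a. x \<le> c \<and> m x = m a + real j / real n * D"
    proof (rule IVT')
      have "real j / real n * D \<le> 1 * D" using that D by (intro mult_right_mono) auto
      then show "m a + real j / real n * D \<le> m c" by (simp add: D_def)
    qed (use D ac cont in auto)
    moreover have "m c = m a + real n / real n * D" using that by (simp add: D_def)
    ultimately show ?thesis using that ac by (cases "j = 0"; cases "j = n") auto
  qed
  then obtain p where p: "\<And>n j. 1 \<le> n \<Longrightarrow> j \<le> n \<Longrightarrow> p n j \<in> {a..c} \<and> (j = 0 \<longrightarrow> p n j = a)
      \<and> (j = n \<longrightarrow> p n j = c) \<and> m (p n j) = m a + real j / real n * D"
    by metis
  \<comment> \<open>The factor \<open>2\<close> makes the tail at each point \<open>2 / n ^ 8\<close>, summable even after the union over the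
    grid.\<close>
  define \<epsilon> where "\<epsilon> n = 2 * sqrt (ln (real n) / real n)" for n :: nat
  \<comment> \<open>For \<open>n < 2\<close> the deviation \<open>\<epsilon> n\<close> is zero and the tail bound does not apply.\<close>
  define Bad where "Bad n = (if n < 2 then {} else
    \<Union>j\<in>{..n}. {\<omega>\<in>space M. \<epsilon> n \<le> \<bar>Z n (p n j) \<omega> - m (p n j)\<bar>})" for n :: nat
  have Bad_sets[measurable]: "Bad n \<in> sets M" for n
    unfolding Bad_def by auto
  have Bad_le: "prob (Bad n) \<le> 4 * (1 / real n ^ 2)" for n
  proof (cases "n < 2")
    case False
    then have n: "2 \<le> n" by simp
    then have ln: "0 < ln (real n)" by simp
    then have \<epsilon>: "0 < \<epsilon> n" and \<epsilon>2: "2 * real n * (\<epsilon> n)\<^sup>2 = 8 * ln (real n)"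
      using n by (auto simp: \<epsilon>_def power_mult_distrib)
    have "prob (Bad n) \<le> (\<Sum>j\<le>n. prob {\<omega>\<in>space M. \<epsilon> n \<le> \<bar>Z n (p n j) \<omega> - m (p n j)\<bar>})"
      using False unfolding Bad_def by (auto intro!: finite_measure_subadditive_finite)
    also have "\<dots> \<le> (\<Sum>j\<le>n. 2 * exp (- 2 * real n * (\<epsilon> n)\<^sup>2))"
      by (intro sum_mono tail \<epsilon>) (use n in auto)
    also have "exp (- 2 * real n * (\<epsilon> n)\<^sup>2) = 1 / real n ^ 8"
    proof -
      have "exp (8 * ln (real n)) = real n ^ 8"
        using exp_of_nat_mult[of 8 "ln (real n)"] n by simp
      then show ?thesis unfolding mult_minus_left \<epsilon>2 by (simp add: exp_minus divide_inverse)
    qed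
    also have "(\<Sum>j\<le>n. 2 * (1 / real n ^ 8)) = 2 * (real n + 1) / real n ^ 8"
      by simp
    also have "\<dots> \<le> 4 * real n ^ 6 / real n ^ 8"
    proof (intro divide_right_mono)
      have "real n ^ 1 \<le> real n ^ 6" using n by (intro power_increasing) auto
      moreover have "1 \<le> real n" using n by simp
      moreover have "2 * (real n + 1) \<le> 4 * u" if "real n ^ 1 \<le> u" "1 \<le> real n" for u :: real
        using that by simp
      ultimately show "2 * (real n + 1) \<le> 4 * real n ^ 6" by blast
    qed simp
    also have "\<dots> = 4 * (1 / real n ^ 2)"
      using n by (simp add: field_simps flip: power_add)
    finally show ?thesis .
  qed (simp add: Bad_def)
  have "summable (\<lambda>n. prob (Bad n))"
  proof (rule summable_comparison_test)
    show "summable (\<lambda>n. 4 * (1 / real n ^ 2))"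
      using inverse_power_summable[of 2, where ?'a = real] by (intro summable_mult) (simp add: divide_inverse)
  qed (use Bad_le in auto)
  then have "AE \<omega> in M. \<forall>\<^sub>F n in sequentially. \<omega> \<in> space M - Bad n"
    by (intro borel_cantelli_AE1) (auto simp: emeasure_eq_measure)
  then have "AE \<omega> in M. \<forall>\<^sub>F n in sequentially.
      \<forall>x\<in>{a..c}. \<bar>Z n x \<omega> - m x\<bar> \<le> (2 + D) * sqrt (ln (real n) / real n)"
  proof eventually_elim
    case (elim \<omega>)
    show ?case
      using elim eventually_ge_at_top[of 3]
    proof eventually_elim
      case (elim n)
      let ?e = "sqrt (ln (real n) / real n)"
      have n: "3 \<le> n" "1 \<le> n" using elim by auto
      have grid: "\<bar>Z n (p n j) \<omega> - m (p n j)\<bar> \<le> 2 * ?e" if "j \<le> n" for j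
        using elim that unfolding Bad_def \<epsilon>_def by (auto simp: not_le intro: less_imp_le)
      have step: "D / real n \<le> D * ?e"
      proof -
        have "1 \<le> ln (real n)"
          using n e_less_272 by (subst ln_ge_iff) auto
        then have "sqrt ((1 / real n)\<^sup>2) \<le> ?e"
          using n by (intro real_sqrt_le_mono) (auto simp: power2_eq_square field_simps
             intro: order.trans[of _ "real n"])
        then have "1 / real n \<le> ?e" by simp
        then show ?thesis using mult_left_mono[OF _ D] by fastforce
      qed
      have cover: "\<exists>j<k. p n j \<le> x \<and> x \<le> p n (Suc j)" if "p n 0 \<le> x" "x \<le> p n k" "1 \<le> k" for x k
        using that
      proof (induction k)
        case (Suc k)
        show ?case
        proof (cases "x \<le> p n k \<and> 1 \<le> k")
          case True
          then show ?thesis using Suc by (auto intro: less_SucI)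
        next
          case False
          then have "p n k \<le> x" using Suc.prems by (cases "k = 0") auto
          then show ?thesis using Suc.prems by auto
        qed
      qed simp
      show ?case
      proof
        fix x assume "x \<in> {a..c}"
        then obtain j where j: "j < n" "p n j \<le> x" "x \<le> p n (Suc j)"
          using cover[of x n] p[OF n(2), of 0] p[OF n(2), of n] n by auto
        have mj: "m (p n (Suc j)) = m (p n j) + D / real n"
          using p[OF n(2), of j] p[OF n(2), of "Suc j"] j by (simp add: field_simps)
        have "m (p n j) \<le> m x" "m x \<le> m (p n (Suc j))"
          using j m_mono by (auto simp: mono_def)
        moreover have "Z n (p n j) \<omega> \<le> Z n x \<omega>" "Z n x \<omega> \<le> Z n (p n (Suc j)) \<omega>"
          using j mono by auto
        moreover have "\<bar>Z n (p n j) \<omega> - m (p n j)\<bar> \<le> 2 * ?e"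
            "\<bar>Z n (p n (Suc j)) \<omega> - m (p n (Suc j))\<bar> \<le> 2 * ?e"
          using grid j by auto
        ultimately show "\<bar>Z n x \<omega> - m x\<bar> \<le> (2 + D) * ?e"
          using mj step by (simp add: algebra_simps abs_le_iff)
      qed
    qed
  qed
  then show ?thesis using D by (intro exI[of _ "2 + D"]) auto
qed

end

section \<open>Integrals against measures with close distribution functions\<close>

lemma down_closed_real_cases:
  fixes D :: "real set"
  assumes "\<And>x y. x \<in> D \<Longrightarrow> y \<le> x \<Longrightarrow> y \<in> D" "D \<subseteq> {..c}"
  obtains "D = {}" | x where "x \<le> c" "D = {..x}" | x where "x \<le> c" "D = {..<x}"
proof (cases "D = {}")
  case False
  have bdd: "bdd_above D" using assms(2) by (auto intro!: bdd_aboveI[of _ c])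
  have le: "Sup D \<le> c" using False assms(2) by (intro cSup_least) auto
  show thesis
  proof (cases "Sup D \<in> D")
    case True
    then have "D = {..Sup D}" using assms(1) bdd by (auto intro: cSup_upper)
    then show thesis using that(2) le by blast
  next
    case no: False
    have "D = {..<Sup D}"
    proof (rule set_eqI, rule iffI)
      fix x assume "x \<in> D"
      then show "x \<in> {..<Sup D}" using cSup_upper[OF _ bdd] no by (metis lessThan_iff order_le_less)
    next
      fix x assume "x \<in> {..<Sup D}"
      then show "x \<in> D" using less_cSup_iff[OF False bdd] assms(1) by (auto intro: less_imp_le)
    qed
    then show thesis using that(3) le by blast
  qed
qed (use that in auto)

text \<open>
  The notion of distance used throughout: only the half-line \<open>{..c}\<close> counts, since beyond the point
  where nobody is left at risk the cumulative hazard cannot be estimated.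
\<close>

definition cdf_close :: "real measure \<Rightarrow> real measure \<Rightarrow> real \<Rightarrow> real \<Rightarrow> bool" where
  "cdf_close \<mu> \<nu> c \<epsilon> \<longleftrightarrow> finite_borel_measure \<mu> \<and> finite_borel_measure \<nu> \<and>
     (\<forall>x\<le>c. \<bar>cdf \<mu> x - cdf \<nu> x\<bar> \<le> \<epsilon>)"

text \<open>
  An interval is the difference of two nested down-closed sets. For a closed half-line the bound is
  the hypothesis, for an open one it follows by taking the limit from the left.
\<close>

lemma cdf_close_interval:
  assumes cl: "cdf_close \<mu> \<nu> c \<epsilon>" and J: "is_interval J" "J \<subseteq> {..c}"
  shows "\<bar>measure \<mu> J - measure \<nu> J\<bar> \<le> 2 * \<epsilon>"
proof -
  interpret \<mu>: finite_borel_measure \<mu> using cl by (simp add: cdf_close_def)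
  interpret \<nu>: finite_borel_measure \<nu> using cl by (simp add: cdf_close_def)
  have cdf: "\<bar>cdf \<mu> x - cdf \<nu> x\<bar> \<le> \<epsilon>" if "x \<le> c" for x
    using cl that by (simp add: cdf_close_def)
  have \<epsilon>: "0 \<le> \<epsilon>" using cdf[of c] by simp
  have down: "\<bar>measure \<mu> D - measure \<nu> D\<bar> \<le> \<epsilon>"
    if D: "\<And>x y. x \<in> D \<Longrightarrow> y \<le> x \<Longrightarrow> y \<in> D" "D \<subseteq> {..c}" for D
  proof (cases rule: down_closed_real_cases[OF D])
    case 3
    then show ?thesis using \<epsilon> by simp
  next
    case (4 x)
    then show ?thesis using cdf by (simp add: cdf_def)
  next
    case (5 x)
    have "((\<lambda>y. \<bar>cdf \<mu> y - cdf \<nu> y\<bar>) \<longlongrightarrow> \<bar>measure \<mu> {..<x} - measure \<nu> {..<x}\<bar>) (at_left x)"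
      by (intro tendsto_intros \<mu>.cdf_at_left \<nu>.cdf_at_left)
    then have "\<bar>measure \<mu> {..<x} - measure \<nu> {..<x}\<bar> \<le> \<epsilon>"
    proof (rule tendsto_upperbound)
      show "\<forall>\<^sub>F y in at_left x. \<bar>cdf \<mu> y - cdf \<nu> y\<bar> \<le> \<epsilon>"
        using cdf 5 by (auto simp: eventually_at_filter)
    qed simp
    then show ?thesis using 5 by simp
  qed
  define D1 where "D1 = {y. \<exists>x\<in>J. y \<le> x}"
  define D2 where "D2 = D1 - J"
  have D1: "\<bar>measure \<mu> D1 - measure \<nu> D1\<bar> \<le> \<epsilon>"
    using J by (intro down) (auto simp: D1_def intro: order.trans)
  have conv: "y \<in> J" if "u \<in> J" "v \<in> J" "u \<le> y" "y \<le> v" for u v y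
    using J that unfolding is_interval_1 by blast
  have D2: "\<bar>measure \<mu> D2 - measure \<nu> D2\<bar> \<le> \<epsilon>"
  proof (rule down)
    show "y \<in> D2" if "x \<in> D2" "y \<le> x" for x y
      using that conv unfolding D2_def D1_def by (auto intro: order.trans)
    show "D2 \<subseteq> {..c}" using J by (auto simp: D2_def D1_def)
  qed
  have "is_interval D1" unfolding is_interval_1 D1_def by (auto intro: order.trans)
  then have sets: "D1 \<in> sets borel" "J \<in> sets borel"
    using J by (auto intro: real_interval_borel_measurable)
  have "J \<subseteq> D1" by (auto simp: D1_def)
  then have "measure \<mu> J = measure \<mu> D1 - measure \<mu> D2" "measure \<nu> J = measure \<nu> D1 - measure \<nu> D2"
    unfolding D2_def using sets by (auto simp: \<mu>.finite_measure_Diff \<nu>.finite_measure_Diff \<mu>.M_is_borel \<nu>.M_is_borel)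
  then show ?thesis using D1 D2 by linarith
qed

text \<open>
  Fubini's theorem for the indicator of the region under the graph of \<open>w\<close>.
\<close>

lemma integral_layer_cake:
  fixes w :: "'a \<Rightarrow> real"
  assumes fin: "finite_measure \<mu>" and w[measurable]: "w \<in> borel_measurable \<mu>"
    and bd: "\<And>x. 0 \<le> w x" "\<And>x. w x \<le> C"
  shows "integrable lborel (\<lambda>u. indicator {0..<C} u * measure \<mu> {x\<in>space \<mu>. u < w x})"
    and "(\<integral>x. w x \<partial>\<mu>) = (\<integral>u. indicator {0..<C} u * measure \<mu> {x\<in>space \<mu>. u < w x} \<partial>lborel)"
proof -
  interpret \<mu>: finite_measure \<mu> by fact
  interpret pair_sigma_finite \<mu> lborel ..
  have C: "0 \<le> C" using bd[of undefined] by linarith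
  let ?f = "\<lambda>x u. indicator {0..<w x} u :: real"
  have int: "integrable (\<mu> \<Otimes>\<^sub>M lborel) (case_prod ?f)"
  proof (rule integrableI_bounded_set)
    show "space \<mu> \<times> {0..<C} \<in> sets (\<mu> \<Otimes>\<^sub>M lborel)" by measurable
    have "{p \<in> space (\<mu> \<Otimes>\<^sub>M lborel). 0 \<le> snd p \<and> snd p < w (fst p)} \<in> sets (\<mu> \<Otimes>\<^sub>M lborel)"
      by measurable
    moreover have "case_prod ?f p
        = indicator {p \<in> space (\<mu> \<Otimes>\<^sub>M lborel). 0 \<le> snd p \<and> snd p < w (fst p)} p"
      if "p \<in> space (\<mu> \<Otimes>\<^sub>M lborel)" for p
      using that by (cases p) (auto simp: indicator_def)
    ultimately show "case_prod ?f \<in> borel_measurable (\<mu> \<Otimes>\<^sub>M lborel)"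
      by (subst measurable_cong) auto
    show "emeasure (\<mu> \<Otimes>\<^sub>M lborel) (space \<mu> \<times> {0..<C}) < \<infinity>"
      using less_top[THEN iffD1, OF \<mu>.emeasure_finite[unfolded infinity_ennreal_def], of "space \<mu>"] C
      by (subst lborel.emeasure_pair_measure_Times)
         (auto simp: ennreal_mult_less_top)
    show "AE p in \<mu> \<Otimes>\<^sub>M lborel. p \<in> space \<mu> \<times> {0..<C} \<longrightarrow> norm (case_prod ?f p) \<le> 1"
      by (auto simp: indicator_def)
    show "AE p in \<mu> \<Otimes>\<^sub>M lborel. p \<notin> space \<mu> \<times> {0..<C} \<longrightarrow> case_prod ?f p = 0"
      using bd by (intro AE_I2) (force simp: indicator_def space_pair_measure intro: less_le_trans)
  qed
  have inner: "(\<integral>x. ?f x u \<partial>\<mu>) = indicator {0..<C} u * measure \<mu> {x\<in>space \<mu>. u < w x}" for u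
  proof -
    have "(\<integral>x. ?f x u \<partial>\<mu>) = (\<integral>x. indicator {0..<C} u * indicator {x\<in>space \<mu>. u < w x} x \<partial>\<mu>)"
      using bd by (intro Bochner_Integration.integral_cong)
        (auto simp: indicator_def intro: less_le_trans)
    then show ?thesis by simp
  qed
  show "integrable lborel (\<lambda>u. indicator {0..<C} u * measure \<mu> {x\<in>space \<mu>. u < w x})"
    using integrable_snd[OF int] unfolding inner .
  have "(\<integral>x. w x \<partial>\<mu>) = (\<integral>x. (\<integral>u. ?f x u \<partial>lborel) \<partial>\<mu>)"
    using bd by (intro Bochner_Integration.integral_cong) (auto simp: measure_def)
  also have "\<dots> = (\<integral>u. (\<integral>x. ?f x u \<partial>\<mu>) \<partial>lborel)"
    using Fubini_integral[OF int] by simp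
  finally show "(\<integral>x. w x \<partial>\<mu>) = (\<integral>u. indicator {0..<C} u * measure \<mu> {x\<in>space \<mu>. u < w x} \<partial>lborel)"
    unfolding inner .
qed

text \<open>
  Super-level sets of non-negative height are intervals in \<open>{..c}\<close>. A function that is monotone and
  non-negative on an interval in \<open>{..c}\<close> and vanishes outside has this property, whichever its direction is.
\<close>

definition quasi_concave_below :: "real \<Rightarrow> (real \<Rightarrow> real) \<Rightarrow> bool" where
  "quasi_concave_below c w \<longleftrightarrow> (\<forall>u\<ge>0. is_interval {x. u < w x} \<and> {x. u < w x} \<subseteq> {..c})"

lemma quasi_concave_below_measurable:
  assumes qc: "quasi_concave_below c w" and nn: "\<And>x. 0 \<le> w x"
  shows "w \<in> borel_measurable borel"
  unfolding borel_measurable_iff_greater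
proof
  fix u show "{x \<in> space borel. u < w x} \<in> sets borel"
  proof (cases "0 \<le> u")
    case True
    then show ?thesis
      using qc by (auto simp: quasi_concave_below_def intro: real_interval_borel_measurable)
  next
    case False
    then have "{x \<in> space borel. u < w x} = UNIV" using nn by (auto intro: less_le_trans[OF _ nn])
    then show ?thesis by simp
  qed
qed

text \<open>
  By the layer-cake formula the difference of the integrals is the integral over the heights
  \<open>u \<in> {0..<C}\<close> of the difference of the measures of the level sets, which are intervals.
\<close>

lemma cdf_close_integral:
  assumes cl: "cdf_close \<mu> \<nu> c \<epsilon>" and qc: "quasi_concave_below c w"
    and bd: "\<And>x. 0 \<le> w x" "\<And>x. w x \<le> C"
  shows "\<bar>(\<integral>x. w x \<partial>\<mu>) - (\<integral>x. w x \<partial>\<nu>)\<bar> \<le> C * (2 * \<epsilon>)"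
proof -
  interpret \<mu>: finite_borel_measure \<mu> using cl by (simp add: cdf_close_def)
  interpret \<nu>: finite_borel_measure \<nu> using cl by (simp add: cdf_close_def)
  have [simp]: "space \<mu> = UNIV" "space \<nu> = UNIV"
    using \<mu>.borel_UNIV \<nu>.borel_UNIV by auto
  have w: "w \<in> borel_measurable \<mu>" "w \<in> borel_measurable \<nu>"
    using quasi_concave_below_measurable[OF qc bd(1)] \<mu>.M_is_borel \<nu>.M_is_borel
    by (auto simp: measurable_cong_sets[OF \<mu>.M_is_borel refl] measurable_cong_sets[OF \<nu>.M_is_borel refl])
  have C: "0 \<le> C" using bd[of 0] by linarith
  note L\<mu> = integral_layer_cake[OF \<mu>.finite_measure_axioms w(1) bd, simplified]
  note L\<nu> = integral_layer_cake[OF \<nu>.finite_measure_axioms w(2) bd, simplified]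
  have "(\<integral>x. w x \<partial>\<mu>) - (\<integral>x. w x \<partial>\<nu>)
      = (\<integral>u. indicator {0..<C} u * (measure \<mu> {x. u < w x} - measure \<nu> {x. u < w x}) \<partial>lborel)"
    unfolding L\<mu>(2) L\<nu>(2) using L\<mu>(1) L\<nu>(1)
    by (simp add: right_diff_distrib Bochner_Integration.integral_diff)
  also have "\<bar>\<dots>\<bar> \<le> (\<integral>u. indicator {0..<C} u * (2 * \<epsilon>) \<partial>lborel)"
  proof (rule integral_abs_bound_integral)
    show "integrable lborel (\<lambda>u. indicator {0..<C} u * (measure \<mu> {x. u < w x} - measure \<nu> {x. u < w x}))"
      using L\<mu>(1) L\<nu>(1) by (simp add: right_diff_distrib)
    show "integrable lborel (\<lambda>u. indicator {0..<C} u * (2 * \<epsilon>))"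
      using C by (intro integrable_mult_left integrable_real_indicator) auto
    show "\<bar>indicator {0..<C} u * (measure \<mu> {x. u < w x} - measure \<nu> {x. u < w x})\<bar>
        \<le> indicator {0..<C} u * (2 * \<epsilon>)" for u
      using qc cdf_close_interval[OF cl, of "{x. u < w x}"]
      by (auto simp: indicator_def quasi_concave_below_def)
  qed
  also have "\<dots> = C * (2 * \<epsilon>)" using C by simp
  finally show ?thesis .
qed

text \<open>
  Jordan decomposition: the variation \<open>V\<close> up to a point and \<open>V - \<phi>\<close> are increasing. A constant is added
  to both so that they become non-negative.
\<close>

lemma bounded_variation_Jordan:
  assumes "bounded_variation_on S \<phi>"
  obtains p q C where "mono_on S p" "mono_on S q" "\<And>x. x \<in> S \<Longrightarrow> \<phi> x = p x - q x"
    "\<And>x. x \<in> S \<Longrightarrow> 0 \<le> p x \<and> p x \<le> C \<and> 0 \<le> q x \<and> q x \<le> C"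
proof (cases "S = {}")
  case True
  show thesis using that[of "\<lambda>_. 0" "\<lambda>_. 0" 0] True by (auto simp: mono_on_def)
next
  case False
  then obtain x0 where x0: "x0 \<in> S" by auto
  define chain where "chain N x \<longleftrightarrow> (\<forall>j\<le>N. x j \<in> S) \<and> (\<forall>j<N. x j < x (Suc j))"
    for N :: nat and x :: "nat \<Rightarrow> real"
  define var where "var N x = (\<Sum>j<N. \<bar>\<phi> (x (Suc j)) - \<phi> (x j)\<bar>)" for N :: nat and x :: "nat \<Rightarrow> real"
  obtain V0 where V0: "\<And>N x. chain N x \<Longrightarrow> var N x \<le> V0"
    using assms unfolding bounded_variation_on_def chain_def var_def by blast
  \<comment> \<open>The chains need not end at \<open>y\<close>: appending a point never lowers the variation, so the supremum
    is the same, and the values for smaller \<open>y\<close> are visibly among those for larger ones.\<close>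
  define A where "A y = {var N x | N x. chain N x \<and> x N \<le> y}" for y
  define V where "V y = Sup (A y)" for y
  have bdd: "bdd_above (A y)" for y
    using V0 by (auto simp: A_def intro!: bdd_aboveI[of _ V0])
  have zero: "0 \<in> A y" if "y \<in> S" for y
    using that unfolding A_def
    by (auto simp: chain_def var_def intro!: exI[of _ "0::nat"] exI[of _ "\<lambda>_. y"])
  have extend: "chain (Suc N) (x(Suc N := z)) \<and> var (Suc N) (x(Suc N := z)) = var N x + \<bar>\<phi> z - \<phi> (x N)\<bar>"
    if "chain N x" "x N < z" "z \<in> S" for N x z
    using that by (auto simp: chain_def var_def less_Suc_eq le_Suc_eq intro!: sum.cong)
  have incr: "V x + \<bar>\<phi> y - \<phi> x\<bar> \<le> V y" if xy: "x \<in> S" "y \<in> S" "x < y" for x y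
  proof -
    have "v \<le> V y - \<bar>\<phi> y - \<phi> x\<bar>" if "v \<in> A x" for v
    proof -
      obtain N z where z: "chain N z" "z N \<le> x" "v = var N z"
        using \<open>v \<in> A x\<close> by (auto simp: A_def)
      have "\<exists>N' z'. chain N' z' \<and> z' N' = x \<and> v \<le> var N' z'"
      proof (cases "z N = x")
        case False
        then have "z N < x" using z by simp
        from extend[OF z(1) this xy(1)] show ?thesis
          using z by (intro exI[of _ "Suc N"] exI[of _ "z(Suc N := x)"]) auto
      qed (use z in auto)
      then obtain N' z' where z': "chain N' z'" "z' N' = x" "v \<le> var N' z'" by blast
      from extend[OF z'(1), of y] z' xy
      have e: "chain (Suc N') (z'(Suc N' := y))" "var (Suc N') (z'(Suc N' := y)) = var N' z' + \<bar>\<phi> y - \<phi> x\<bar>"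
        by auto
      have "var (Suc N') (z'(Suc N' := y)) \<in> A y"
        unfolding A_def using e(1) by (auto intro!: exI[of _ "Suc N'"] exI[of _ "z'(Suc N' := y)"])
      then have "var (Suc N') (z'(Suc N' := y)) \<le> V y"
        unfolding V_def by (rule cSup_upper[OF _ bdd])
      then show ?thesis using e z' by simp
    qed
    then have "V x \<le> V y - \<bar>\<phi> y - \<phi> x\<bar>"
      unfolding V_def[of x] using zero[OF xy(1)] by (intro cSup_least) auto
    then show ?thesis by simp
  qed
  have V_nonneg: "0 \<le> V y" if "y \<in> S" for y
    unfolding V_def by (rule cSup_upper[OF zero[OF that] bdd])
  have V_le: "V y \<le> V0" if "y \<in> S" for y
    unfolding V_def using zero[OF that] V0 by (intro cSup_least) (auto simp: A_def)
  define B where "B = \<bar>\<phi> x0\<bar> + V0"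
  have \<phi>_bd: "\<bar>\<phi> y\<bar> \<le> B" if "y \<in> S" for y
  proof -
    have "\<bar>\<phi> y - \<phi> x0\<bar> \<le> V0"
      using incr[OF that x0] incr[OF x0 that] V_nonneg[OF that] V_nonneg[OF x0] V_le[OF that] V_le[OF x0]
      by (cases y x0 rule: linorder_cases) auto
    then show ?thesis by (auto simp: B_def)
  qed
  show thesis
  proof (rule that[of "\<lambda>y. V y + B" "\<lambda>y. V y - \<phi> y + B" "V0 + 2 * B"])
    show "mono_on S (\<lambda>y. V y + B)" "mono_on S (\<lambda>y. V y - \<phi> y + B)"
      using incr by (fastforce simp: mono_on_def order_le_less)+
    show "0 \<le> V y + B \<and> V y + B \<le> V0 + 2 * B \<and> 0 \<le> V y - \<phi> y + B \<and> V y - \<phi> y + B \<le> V0 + 2 * B"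
      if "y \<in> S" for y
      using V_nonneg[OF that] V_le[OF that] \<phi>_bd[OF that] by auto
  qed simp
qed

lemma bounded_variation_bounded:
  fixes k :: "real \<Rightarrow> real"
  assumes bv: "bounded_variation_on S k" and k0: "\<And>t. t \<notin> S \<Longrightarrow> k t = 0"
  obtains B where "\<And>t. \<bar>k t\<bar> \<le> B"
proof -
  obtain p q C where "mono_on S p" "mono_on S q" and pq: "\<And>x. x \<in> S \<Longrightarrow> k x = p x - q x"
    "\<And>x. x \<in> S \<Longrightarrow> 0 \<le> p x \<and> p x \<le> C \<and> 0 \<le> q x \<and> q x \<le> C"
    using bounded_variation_Jordan[OF bv] by blast
  have "\<bar>k t\<bar> \<le> \<bar>C\<bar>" for t
    using k0[of t] pq(1)[of t] pq(2)[of t] by (cases "t \<in> S") auto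
  then show thesis using that by blast
qed

text \<open>
  The substitution \<open>x \<mapsto> (t - x) / h\<close> turns the two increasing parts of the kernel into functions
  that decrease on an interval. Since \<open>r\<close> is the left end of the support, this interval lies in
  \<open>{..c}\<close> when \<open>t - r * h \<le> c\<close>. The constant depends on the kernel only.
\<close>

lemma cdf_close_kernel_integral:
  assumes bv: "bounded_variation_on {r<..<s} k" and k0: "\<And>t. t \<notin> {r<..<s} \<Longrightarrow> k t = 0"
  obtains C where "0 \<le> C" "\<And>\<mu> \<nu> c \<epsilon> a h t. cdf_close \<mu> \<nu> c \<epsilon> \<Longrightarrow> 0 < h \<Longrightarrow> t - r * h \<le> c \<Longrightarrow>
    \<bar>(LINT x:{a..}|\<mu>. k ((t - x) / h)) - (LINT x:{a..}|\<nu>. k ((t - x) / h))\<bar> \<le> C * \<epsilon>"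
proof -
  obtain p q C where pq: "mono_on {r<..<s} p" "mono_on {r<..<s} q"
    "\<And>x. x \<in> {r<..<s} \<Longrightarrow> k x = p x - q x"
    "\<And>x. x \<in> {r<..<s} \<Longrightarrow> 0 \<le> p x \<and> p x \<le> C \<and> 0 \<le> q x \<and> q x \<le> C"
    using bounded_variation_Jordan[OF bv] by blast
  define C' where "C' = max C 0"
  show thesis
  proof (rule that[of "4 * C'"])
    show "0 \<le> 4 * C'" by (simp add: C'_def)
    fix \<mu> \<nu> c \<epsilon> a h t
    assume cl: "cdf_close \<mu> \<nu> c \<epsilon>" and h: "0 < h" and t: "t - r * h \<le> c"
    let ?z = "\<lambda>x. (t - x) / h"
    let ?I = "{x. a \<le> x \<and> ?z x \<in> {r<..<s}}"
    define w where "w m x = indicator ?I x * m (?z x)" for m :: "real \<Rightarrow> real" and x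
    have qc: "quasi_concave_below c (w m)" and wb: "0 \<le> w m x" "w m x \<le> C'"
      if "mono_on {r<..<s} m" "\<And>x. x \<in> {r<..<s} \<Longrightarrow> 0 \<le> m x \<and> m x \<le> C" for m x
    proof -
      show "0 \<le> w m x" "w m x \<le> C'"
        using that(2)[of "?z x"] by (auto simp: w_def C'_def indicator_def)
      show "quasi_concave_below c (w m)"
        unfolding quasi_concave_below_def
      proof (intro allI impI conjI)
        fix u :: real assume u: "0 \<le> u"
        have eq: "{x. u < w m x} = {x \<in> ?I. u < m (?z x)}"
          using u by (auto simp: w_def indicator_def)
        show "is_interval {x. u < w m x}"
          unfolding eq is_interval_1
        proof (intro ballI allI impI)
          fix x y z assume x: "x \<in> {x \<in> ?I. u < m (?z x)}" and y: "y \<in> {x \<in> ?I. u < m (?z x)}"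
            and z: "x \<le> z \<and> z \<le> y"
          have "?z y \<le> ?z z" "?z z \<le> ?z x" using z h by (auto intro: divide_right_mono)
          then have "?z z \<in> {r<..<s}" "m (?z y) \<le> m (?z z)"
            using x y that(1) by (auto simp: mono_on_def)
          then show "z \<in> {x \<in> ?I. u < m (?z x)}" using x y z by auto
        qed
        have "x \<le> c" if "r < ?z x" for x
        proof -
          have "r * h < t - x" using that h by (simp add: pos_less_divide_eq)
          then show ?thesis using t by simp
        qed
        then show "{x. u < w m x} \<subseteq> {..c}" unfolding eq by auto
      qed
    qed
    have split: "(LINT x:{a..}|\<kappa>. k (?z x)) = (\<integral>x. w p x \<partial>\<kappa>) - (\<integral>x. w q x \<partial>\<kappa>)"
      if "finite_borel_measure \<kappa>" for \<kappa>
    proof -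
      interpret finite_borel_measure \<kappa> by fact
      have int: "integrable \<kappa> (w m)"
        if m: "mono_on {r<..<s} m" "\<And>x. x \<in> {r<..<s} \<Longrightarrow> 0 \<le> m x \<and> m x \<le> C" for m
      proof (rule integrable_const_bound[of _ C'])
        show "w m \<in> borel_measurable \<kappa>"
          using quasi_concave_below_measurable[OF qc[OF m] wb(1)[OF m]]
          by (simp add: measurable_cong_sets[OF M_is_borel refl])
      qed (use wb[OF m] in auto)
      have "(LINT x:{a..}|\<kappa>. k (?z x)) = (\<integral>x. w p x - w q x \<partial>\<kappa>)"
        unfolding set_lebesgue_integral_def
        using pq(3) k0 by (intro Bochner_Integration.integral_cong) (auto simp: w_def indicator_def)
      also have "\<dots> = (\<integral>x. w p x \<partial>\<kappa>) - (\<integral>x. w q x \<partial>\<kappa>)"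
        using int pq by (intro Bochner_Integration.integral_diff) auto
      finally show ?thesis .
    qed
    have "\<bar>(\<integral>x. w p x \<partial>\<mu>) - (\<integral>x. w p x \<partial>\<nu>)\<bar> \<le> C' * (2 * \<epsilon>)"
      by (rule cdf_close_integral[OF cl qc wb]) (use pq in auto)
    moreover have "\<bar>(\<integral>x. w q x \<partial>\<mu>) - (\<integral>x. w q x \<partial>\<nu>)\<bar> \<le> C' * (2 * \<epsilon>)"
      by (rule cdf_close_integral[OF cl qc wb]) (use pq in auto)
    moreover have "finite_borel_measure \<mu>" "finite_borel_measure \<nu>"
      using cl by (auto simp: cdf_close_def)
    ultimately show "\<bar>(LINT x:{a..}|\<mu>. k (?z x)) - (LINT x:{a..}|\<nu>. k (?z x))\<bar> \<le> 4 * C' * \<epsilon>"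
      by (simp add: split)
  qed
qed

section \<open>The estimators as step functions\<close>

text \<open>
  Integrals against the Lebesgue-Stieltjes measure of a step function become finite sums through
  this representation by point masses. Several indices may share the same location.
\<close>

lemma interval_measure_step_function:
  fixes c p :: "'b \<Rightarrow> real"
  assumes S: "finite S" and c: "\<And>t. t \<in> S \<Longrightarrow> 0 \<le> c t"
  defines "F \<equiv> \<lambda>x. \<Sum>t\<in>S. if p t \<le> x then c t else 0"
  shows "interval_measure F = distr (point_measure S c) borel p"
proof (rule measure_eqI_generator_eq[where \<Omega> = UNIV])
  have F: "mono F" "\<And>y. continuous (at_right y) F"
    unfolding F_def by (rule step_function_Stieltjes[OF S c]; assumption)+
  have F_diff: "F b - F a = (\<Sum>t\<in>{t\<in>S. a < p t \<and> p t \<le> b}. c t)" if "a \<le> b" for a b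
  proof -
    have "F b - F a = (\<Sum>t\<in>S. if a < p t \<and> p t \<le> b then c t else 0)"
      unfolding F_def sum_subtractf[symmetric] using that by (intro sum.cong) auto
    then show ?thesis using S by (simp add: sum.inter_filter)
  qed
  have D: "emeasure (distr (point_measure S c) borel p) {a<..b} = ennreal (F b - F a)"
    if "a \<le> b" for a b
  proof -
    have "emeasure (distr (point_measure S c) borel p) {a<..b}
        = emeasure (point_measure S c) {t\<in>S. a < p t \<and> p t \<le> b}"
      by (subst emeasure_distr) (auto simp: space_point_measure intro!: arg_cong[where f = "emeasure _"])
    also have "\<dots> = (\<Sum>t\<in>{t\<in>S. a < p t \<and> p t \<le> b}. ennreal (c t))"
      using S by (intro emeasure_point_measure_finite) auto
    also have "\<dots> = ennreal (F b - F a)"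
      using c unfolding F_diff[OF that] by (intro sum_ennreal) auto
    finally show ?thesis .
  qed
  have I: "emeasure (interval_measure F) {a<..b} = ennreal (F b - F a)" if "a \<le> b" for a b
    using F that by (intro emeasure_interval_measure_Ioc) (auto simp: mono_def)
  fix X assume "X \<in> range (\<lambda>(a, b). {a<..b::real})"
  then obtain a b where "X = {a<..b}" by auto
  then show "emeasure (interval_measure F) X = emeasure (distr (point_measure S c) borel p) X"
    by (cases "a \<le> b") (simp_all add: I D)
next
  show "(\<Union>i. {- real (i::nat)<..real i}) = UNIV"
    by (rule UN_Ioc_eq_UNIV)
  show "emeasure (interval_measure F) {- real i<..real i} \<noteq> \<infinity>" for i
    unfolding F_def using step_function_Stieltjes[where c = c and p = p, OF S c]
    by (subst emeasure_interval_measure_Ioc) (auto dest: monoD)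
qed (auto simp: borel_sigma_sets_Ioc Int_stable_def)

lemma
  fixes c p :: "'b \<Rightarrow> real"
  assumes S: "finite S" and c: "\<And>t. t \<in> S \<Longrightarrow> 0 \<le> c t"
    and F: "\<And>x. F x = (\<Sum>t\<in>S. if p t \<le> x then c t else 0)"
  shows finite_borel_measure_step_function: "finite_borel_measure (interval_measure F)"
    and cdf_interval_measure_step_function: "cdf (interval_measure F) x = F x"
    and integral_interval_measure_step_function:
      "\<And>\<phi>. \<phi> \<in> borel_measurable borel \<Longrightarrow> (\<integral>x. \<phi> x \<partial>interval_measure F) = (\<Sum>t\<in>S. c t * \<phi> (p t))"
proof -
  have F': "F = (\<lambda>x. \<Sum>t\<in>S. if p t \<le> x then c t else 0)" using F by auto
  have eq: "interval_measure F = distr (point_measure S c) borel p"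
    unfolding F' by (rule interval_measure_step_function[OF S c])
  have p: "p \<in> measurable (point_measure S c) borel" by simp
  have fin: "emeasure (point_measure S c) (space (point_measure S c)) \<noteq> \<infinity>"
    using S by (simp add: space_point_measure emeasure_point_measure_finite)
  then show "finite_borel_measure (interval_measure F)"
    unfolding eq using p
    by (intro finite_borel_measure.intro finite_measure.finite_measure_distr finite_measureI)
       (auto simp: finite_borel_measure_axioms_def)
  show "(\<integral>x. \<phi> x \<partial>interval_measure F) = (\<Sum>t\<in>S. c t * \<phi> (p t))"
    if "\<phi> \<in> borel_measurable borel" for \<phi>
    unfolding eq using S c that by (subst integral_distr) (auto simp: lebesgue_integral_point_measure_finite)
  from this[of "indicator {..x}"] have "cdf (interval_measure F) x = (\<Sum>t\<in>S. c t * indicator {..x} (p t))"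
    by (simp add: cdf_def del: integral_indicator flip: integral_indicator)
  then show "cdf (interval_measure F) x = F x"
    unfolding F by (auto simp: indicator_def intro!: sum.cong)
qed

lemma sub_edf_eq:
  "sub_edf T Y n \<omega> x = (\<Sum>i\<in>{i\<in>{1..n}. uncensored T Y i \<omega>}. if obs T Y i \<omega> \<le> x then 1 / real n else 0)"
proof -
  have "{i\<in>{1..n}. obs T Y i \<omega> \<le> x \<and> uncensored T Y i \<omega>}
      = {i\<in>{1..n}. uncensored T Y i \<omega>} \<inter> {i. obs T Y i \<omega> \<le> x}" by auto
  then show ?thesis
    by (simp add: sub_edf_def death_count_def sum.If_cases)
qed

text \<open>
  Indexing by observations instead of jump times: tied observations have the same number at risk,
  so a jump of height \<open>d\<close> splits into \<open>d\<close> equal terms.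
\<close>

lemma cum_hazard_est_eq:
  "cum_hazard_est T Y n \<omega> x = (\<Sum>i\<in>{i\<in>{1..n}. uncensored T Y i \<omega>}.
     if obs T Y i \<omega> \<le> x then 1 / real (at_risk T Y n \<omega> (obs T Y i \<omega>)) else 0)"
proof -
  let ?U = "{i\<in>{1..n}. uncensored T Y i \<omega> \<and> obs T Y i \<omega> \<le> x}"
  let ?r = "\<lambda>t. real (at_risk T Y n \<omega> t)"
  have fib: "{i\<in>?U. obs T Y i \<omega> = t} = {i\<in>{1..n}. obs T Y i \<omega> = t \<and> uncensored T Y i \<omega>}" if "t \<le> x" for t
    using that by auto
  have "{t. t \<le> x \<and> 0 < death_jump T Y n \<omega> t} = (\<lambda>i. obs T Y i \<omega>) ` ?U"
    by (auto simp: death_jump_eq card_gt_0_iff)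
  then have "cum_hazard_est T Y n \<omega> x
      = (\<Sum>t\<in>(\<lambda>i. obs T Y i \<omega>) ` ?U. \<Sum>i\<in>{i\<in>?U. obs T Y i \<omega> = t}. 1 / ?r (obs T Y i \<omega>))"
    unfolding cum_hazard_est_def
  proof (intro sum.cong refl)
    fix t assume "t \<in> (\<lambda>i. obs T Y i \<omega>) ` ?U"
    then have "t \<le> x" by auto
    have "(\<Sum>i\<in>{i\<in>?U. obs T Y i \<omega> = t}. 1 / ?r (obs T Y i \<omega>)) = (\<Sum>i\<in>{i\<in>?U. obs T Y i \<omega> = t}. 1 / ?r t)"
      by (intro sum.cong) auto
    then show "death_jump T Y n \<omega> t / ?r t = (\<Sum>i\<in>{i\<in>?U. obs T Y i \<omega> = t}. 1 / ?r (obs T Y i \<omega>))"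
      by (simp only: death_jump_eq fib[OF \<open>t \<le> x\<close>] sum_constant) simp
  qed
  also have "\<dots> = (\<Sum>i\<in>?U. 1 / ?r (obs T Y i \<omega>))"
    by (rule sum.image_gen[symmetric]) simp
  also have "?U = {i\<in>{i\<in>{1..n}. uncensored T Y i \<omega>}. obs T Y i \<omega> \<le> x}" by auto
  finally show ?thesis by (subst (asm) sum.inter_filter) auto
qed

text \<open>
  The estimator is the integral of \<open>1 / B_n\<close> against the empirical sub-distribution, with
  \<open>B_n = at_risk / n\<close>, and its target is the integral of \<open>1 / B\<close> against \<open>\<nu>\<close>. Replacing \<open>1 / B_n\<close> by
  \<open>1 / B\<close> costs \<open>2 * \<epsilon> / (B c)\<^sup>2\<close>, because \<open>B_n\<close> is at least \<open>B c / 2\<close>. Replacing the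
  sub-distribution by \<open>\<nu>\<close> costs \<open>2 * \<epsilon> / B c\<close>, because on \<open>{..c}\<close> the function
  \<open>1 / B\<close> is increasing and at most \<open>1 / B c\<close>.
\<close>

lemma cum_hazard_est_cdf_close:
  fixes B :: "real \<Rightarrow> real"
  assumes n: "1 \<le> n"
    and A: "cdf_close (interval_measure (sub_edf T Y n \<omega>)) \<nu> c \<epsilon>"
    and R: "\<And>x. x \<le> c \<Longrightarrow> \<bar>real (at_risk T Y n \<omega> x) / real n - B x\<bar> \<le> \<epsilon>"
    and B: "antimono B" "0 < B c" and \<epsilon>: "\<epsilon> \<le> B c / 2"
    and \<kappa>: "finite_borel_measure \<kappa>" "\<And>x. x \<le> c \<Longrightarrow> cdf \<kappa> x = (\<integral>z. indicator {..x} z / B z \<partial>\<nu>)"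
  shows "cdf_close (interval_measure (cum_hazard_est T Y n \<omega>)) \<kappa> c ((2 / (B c)\<^sup>2 + 2 / B c) * \<epsilon>)"
proof -
  let ?U = "{i\<in>{1..n}. uncensored T Y i \<omega>}" and ?X = "\<lambda>i. obs T Y i \<omega>"
  let ?r = "\<lambda>t. real (at_risk T Y n \<omega> t)"
  have B_le: "B c \<le> B x" if "x \<le> c" for x using B that by (auto simp: antimono_def)
  have B_pos: "0 < B x" if "x \<le> c" for x using B_le[OF that] B(2) by linarith
  have \<epsilon>0: "0 \<le> \<epsilon>" using R[of c] by simp
  note H = cum_hazard_est_eq[of T Y n \<omega>]
  have fbH: "finite_borel_measure (interval_measure (cum_hazard_est T Y n \<omega>))"
    and cdfH: "\<And>x. cdf (interval_measure (cum_hazard_est T Y n \<omega>)) x = cum_hazard_est T Y n \<omega> x"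
    by (rule finite_borel_measure_step_function[OF _ _ H] cdf_interval_measure_step_function[OF _ _ H]; simp)+
  have "\<bar>cum_hazard_est T Y n \<omega> x - cdf \<kappa> x\<bar> \<le> (2 / (B c)\<^sup>2 + 2 / B c) * \<epsilon>" if x: "x \<le> c" for x
  proof -
    define w where "w z = indicator {..x} z / B z" for z
    have w: "0 \<le> w z" "w z \<le> 1 / B c" for z
      using B_le[of z] B_pos[of z] B(2) x by (auto simp: w_def indicator_def intro!: divide_left_mono)
    have qc: "quasi_concave_below c w"
      unfolding quasi_concave_below_def is_interval_1
    proof (intro allI impI conjI ballI)
      fix u y z v assume u: "(0::real) \<le> u" and y: "y \<in> {x. u < w x}" "z \<in> {x. u < w x}" and v: "y \<le> v \<and> v \<le> z"
      have zx: "z \<le> x" using y(2) u by (cases "z \<le> x") (auto simp: w_def)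
      have "u < 1 / B y" using y(1) u by (cases "y \<le> x") (auto simp: w_def)
      also have "1 / B y \<le> 1 / B v"
        using B_pos[of v] B_pos[of y] B(1) v zx x by (intro divide_left_mono) (auto simp: antimono_def)
      finally show "v \<in> {x. u < w x}" using v zx by (auto simp: w_def indicator_def)
    next
      fix u :: real assume "0 \<le> u"
      then have "z \<le> x" if "u < w z" for z using that by (cases "z \<le> x") (auto simp: w_def)
      then show "{z. u < w z} \<subseteq> {..c}" using x by force
    qed
    have "(\<integral>z. w z \<partial>interval_measure (sub_edf T Y n \<omega>)) = (\<Sum>i\<in>?U. 1 / real n * w (?X i))"
      using quasi_concave_below_measurable[OF qc w(1)]
      by (intro integral_interval_measure_step_function[OF _ _ sub_edf_eq]) auto
    moreover have "\<bar>(\<integral>z. w z \<partial>interval_measure (sub_edf T Y n \<omega>)) - (\<integral>z. w z \<partial>\<nu>)\<bar> \<le> 1 / B c * (2 * \<epsilon>)"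
      by (rule cdf_close_integral[OF A qc w])
    moreover have "(\<integral>z. w z \<partial>\<nu>) = cdf \<kappa> x"
      using \<kappa>(2)[OF x] by (simp add: w_def)
    moreover have "\<bar>cum_hazard_est T Y n \<omega> x - (\<Sum>i\<in>?U. 1 / real n * w (?X i))\<bar> \<le> 2 / (B c)\<^sup>2 * \<epsilon>"
    proof -
      have "\<bar>(if ?X i \<le> x then 1 / ?r (?X i) else 0) - 1 / real n * w (?X i)\<bar> \<le> 1 / real n * (2 / (B c)\<^sup>2 * \<epsilon>)"
        for i
      proof (cases "?X i \<le> x")
        case True
        let ?b = "?r (?X i) / real n"
        have c: "?X i \<le> c" using True x by simp
        have b: "B c / 2 \<le> ?b" using R[OF c] B_le[OF c] \<epsilon> by (auto simp: abs_le_iff)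
        then have bp: "0 < ?b" using B(2) by linarith
        let ?q = "(B (?X i) - ?b) / (?b * B (?X i))"
        have eq: "1 / ?r (?X i) - 1 / real n * w (?X i) = 1 / real n * ?q"
          using True bp B_pos[OF c] n by (simp add: w_def field_simps)
        have "\<bar>?q\<bar> \<le> \<epsilon> / (B c / 2 * B c)"
          unfolding abs_divide
        proof (rule frac_le)
          show "\<bar>B (?X i) - ?b\<bar> \<le> \<epsilon>" using R[OF c] by (simp add: abs_minus_commute)
          have "B c / 2 * B c \<le> ?b * B (?X i)"
            using b B_le[OF c] B(2) bp by (intro mult_mono) auto
          then show "B c / 2 * B c \<le> \<bar>?b * B (?X i)\<bar>" by linarith
        qed (use \<epsilon>0 B(2) in auto)
        also have "\<epsilon> / (B c / 2 * B c) = 2 / (B c)\<^sup>2 * \<epsilon>" by (simp add: power2_eq_square)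
        finally have "1 / real n * \<bar>?q\<bar> \<le> 1 / real n * (2 / (B c)\<^sup>2 * \<epsilon>)"
          by (rule mult_left_mono) simp
        moreover have "\<bar>1 / ?r (?X i) - 1 / real n * w (?X i)\<bar> = 1 / real n * \<bar>?q\<bar>"
          unfolding eq abs_mult by simp
        ultimately show ?thesis
          using True by (simp only: if_True)
      next
        case False
        then show ?thesis using \<epsilon>0 by (simp add: w_def)
      qed
      then have "\<bar>cum_hazard_est T Y n \<omega> x - (\<Sum>i\<in>?U. 1 / real n * w (?X i))\<bar>
          \<le> (\<Sum>i\<in>?U. 1 / real n * (2 / (B c)\<^sup>2 * \<epsilon>))"
        unfolding cum_hazard_est_eq sum_subtractf[symmetric] by (intro order.trans[OF sum_abs] sum_mono) auto
      also have "\<dots> = real (card ?U) * (1 / real n * (2 / (B c)\<^sup>2 * \<epsilon>))"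
        by simp
      also have "\<dots> \<le> real n * (1 / real n * (2 / (B c)\<^sup>2 * \<epsilon>))"
      proof (rule mult_right_mono)
        have "card ?U \<le> card {1..n}" by (rule card_mono) auto
        then show "real (card ?U) \<le> real n" by simp
      qed (use \<epsilon>0 in simp)
      also have "\<dots> = 2 / (B c)\<^sup>2 * \<epsilon>" using n by simp
      finally show ?thesis .
    qed
    ultimately show ?thesis by (simp add: algebra_simps)
  qed
  then show ?thesis using fbH cdfH \<kappa>(1) by (auto simp: cdf_close_def)
qed

section \<open>Laws and uniform rates for censored negatively associated data\<close>

locale censored_neg_assoc = prob_space M for M :: "'a measure" +
  fixes T Y :: "nat \<Rightarrow> 'a \<Rightarrow> real" and F f G g :: "real \<Rightarrow> real"
  assumes T_nonneg: "\<And>i \<omega>. 1 \<le> i \<Longrightarrow> \<omega> \<in> space M \<Longrightarrow> 0 \<le> T i \<omega>"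
    and Y_nonneg: "\<And>i \<omega>. 1 \<le> i \<Longrightarrow> \<omega> \<in> space M \<Longrightarrow> 0 \<le> Y i \<omega>"
    and na: "neg_assoc M {1..} T" "neg_assoc M {1..} Y"
    and ind: "indep_var (PiM {1..} (\<lambda>_. borel)) (\<lambda>\<omega>. \<lambda>i\<in>{1..}. T i \<omega>)
      (PiM {1..} (\<lambda>_. borel)) (\<lambda>\<omega>. \<lambda>i\<in>{1..}. Y i \<omega>)"
    and cdf_T: "\<And>i. 1 \<le> i \<Longrightarrow> cdf (distr M borel (T i)) = F"
    and f_nonneg: "\<And>x. 0 \<le> f x"
    and f: "\<And>i. 1 \<le> i \<Longrightarrow> distributed M lborel (T i) (\<lambda>x. ennreal (f x))"
    and cdf_Y: "\<And>i. 1 \<le> i \<Longrightarrow> cdf (distr M borel (Y i)) = G"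
    and g: "\<And>i. 1 \<le> i \<Longrightarrow> distributed M lborel (Y i) (\<lambda>x. ennreal (g x))"

text \<open>
  A law with a Lebesgue density has no atoms. This gives the continuity of its distribution function
  and makes strict and weak inequalities equally likely.
\<close>

lemma (in prob_space) distributed_lborel_cdf:
  assumes X: "distributed M lborel X (\<lambda>x. ennreal (d x))" and D: "cdf (distr M borel X) = D"
  shows "X \<in> borel_measurable M"
    and "isCont D x" and "mono D" and "0 \<le> D x" and "D x \<le> 1"
    and "prob {\<omega>\<in>space M. X \<omega> \<le> x} = D x"
    and "prob {\<omega>\<in>space M. x < X \<omega>} = 1 - D x"
    and "prob {\<omega>\<in>space M. x \<le> X \<omega>} = 1 - D x"
proof -
  show X_meas[measurable]: "X \<in> borel_measurable M"
    using X by (simp add: distributed_def)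
  interpret D: real_distribution "distr M borel X" by simp
  have "emeasure M (X -` {x} \<inter> space M) = (\<integral>\<^sup>+y. ennreal (d y) * indicator {x} y \<partial>lborel)" for x
    by (rule distributed_emeasure[OF X]) simp
  also have "(\<integral>\<^sup>+y. ennreal (d y) * indicator {x} y \<partial>lborel) = 0" for x
    using AE_lborel_singleton[of x] by (intro nn_integral_zero') (auto elim: eventually_mono)
  finally have atom: "prob {\<omega>\<in>space M. X \<omega> = x} = 0" for x
    by (simp add: measure_def vimage_def Int_def conj_commute)
  have "measure (distr M borel X) {x} = 0"
    using atom by (subst measure_distr) (auto simp: vimage_def Int_def conj_commute)
  then show "isCont D x" using D.isCont_cdf D by simp
  show "mono D" using D.cdf_nondecreasing D by (auto simp: mono_def)
  show "0 \<le> D x" "D x \<le> 1" using D.cdf_nonneg[of x] D.cdf_bounded_prob[of x] D by auto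
  show le: "prob {\<omega>\<in>space M. X \<omega> \<le> x} = D x"
    unfolding D[symmetric] cdf_def by (subst measure_distr) (auto intro!: arg_cong[where f = prob])
  have "prob (space M - {\<omega>\<in>space M. X \<omega> \<le> x}) = 1 - D x"
    using le by (subst prob_compl) auto
  also have "space M - {\<omega>\<in>space M. X \<omega> \<le> x} = {\<omega>\<in>space M. x < X \<omega>}" by auto
  finally show gt: "prob {\<omega>\<in>space M. x < X \<omega>} = 1 - D x" .
  have "{\<omega>\<in>space M. x \<le> X \<omega>} = {\<omega>\<in>space M. x < X \<omega>} \<union> {\<omega>\<in>space M. X \<omega> = x}" by auto
  moreover have "prob ({\<omega>\<in>space M. x < X \<omega>} \<union> {\<omega>\<in>space M. X \<omega> = x}) = 1 - D x"
    using gt atom by (subst finite_measure_Union) auto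
  ultimately show "prob {\<omega>\<in>space M. x \<le> X \<omega>} = 1 - D x" by simp
qed

context censored_neg_assoc
begin

lemmas T_law = distributed_lborel_cdf[OF f cdf_T]
lemmas Y_law = distributed_lborel_cdf[OF g cdf_Y]

lemma T_meas[measurable]: "1 \<le> i \<Longrightarrow> T i \<in> borel_measurable M"
  by (rule T_law(1))

lemma Y_meas[measurable]: "1 \<le> i \<Longrightarrow> Y i \<in> borel_measurable M"
  by (rule Y_law(1))

lemma F_cdf: "isCont F x" "mono F" "0 \<le> F x" "F x \<le> 1"
  using T_law(2-5)[of 1] by auto

lemma G_cdf: "isCont G x" "mono G" "0 \<le> G x" "G x \<le> 1"
  using Y_law(2-5)[of 1] by auto

lemma cdf_negative: "x < 0 \<Longrightarrow> F x = 0" "x < 0 \<Longrightarrow> G x = 0"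
proof -
  assume x: "x < 0"
  have e: "{\<omega>\<in>space M. T 1 \<omega> \<le> x} = {}" "{\<omega>\<in>space M. Y 1 \<omega> \<le> x} = {}"
    using T_nonneg[of 1] Y_nonneg[of 1] x by fastforce+
  show "F x = 0" "G x = 0" using T_law(6)[of 1 x] Y_law(6)[of 1 x] unfolding e by simp_all
qed

lemma f_measurable[measurable]: "f \<in> borel_measurable borel"
  using distributed_real_measurable[OF _ f[of 1]] f_nonneg by simp

lemma F_measurable[measurable]: "F \<in> borel_measurable borel"
  and G_measurable[measurable]: "G \<in> borel_measurable borel"
  using F_cdf G_cdf by (auto intro: borel_measurable_mono)

text \<open>
  A density is determined almost everywhere only, so non-negativity of \<open>T i\<close> gives no more than this.
\<close>

lemma f_negative: "AE x in lborel. x < 0 \<longrightarrow> f x = 0"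
proof -
  have "T 1 -` {..<0} \<inter> space M = {}" using T_nonneg[of 1] by fastforce
  moreover have "emeasure M (T 1 -` {..<0} \<inter> space M) = (\<integral>\<^sup>+x. ennreal (f x) * indicator {..<0} x \<partial>lborel)"
    by (rule distributed_emeasure[OF f]) auto
  ultimately have "(\<integral>\<^sup>+x. ennreal (f x) * indicator {..<0} x \<partial>lborel) = 0" by simp
  then have "AE x in lborel. ennreal (f x) * indicator {..<0} x = 0"
    by (subst (asm) nn_integral_0_iff_AE) auto
  then show ?thesis
    by eventually_elim (use f_nonneg in \<open>auto simp: indicator_def split: if_splits\<close>)
qed

text \<open>
  The survival function \<open>1 - L\<close> of the observed minimum, see \<open>cdf_obs\<close>.
\<close>

definition joint_survival :: "real \<Rightarrow> real" where
  "joint_survival x = (1 - F x) * (1 - G x)"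

lemma joint_survival_antimono: "antimono joint_survival"
  using F_cdf G_cdf unfolding joint_survival_def antimono_def
  by (auto intro!: mult_mono dest: monoD)

lemma isCont_joint_survival: "isCont joint_survival x"
  unfolding joint_survival_def[abs_def] using F_cdf G_cdf by (intro continuous_intros) auto

lemma joint_survival_negative: "x < 0 \<Longrightarrow> joint_survival x = 1"
  by (simp add: joint_survival_def cdf_negative)

lemma expectation_indicator_pair:
  assumes i: "1 \<le> i" and A: "A \<in> sets borel"
  shows "expectation (\<lambda>\<omega>. indicator A (T i \<omega>) * indicator A (Y i \<omega>) :: real)
    = prob {\<omega>\<in>space M. T i \<omega> \<in> A} * prob {\<omega>\<in>space M. Y i \<omega> \<in> A}"
proof -
  note [measurable] = A T_meas[OF i] Y_meas[OF i]
  have e: "expectation (\<lambda>\<omega>. indicator A (X \<omega>) :: real) = prob {\<omega>\<in>space M. X \<omega> \<in> A}"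
    if [measurable]: "X \<in> borel_measurable M" for X
  proof -
    have "expectation (\<lambda>\<omega>. indicator A (X \<omega>) :: real) = expectation (indicator {\<omega>\<in>space M. X \<omega> \<in> A})"
      by (intro Bochner_Integration.integral_cong) (auto simp: indicator_def)
    then show ?thesis by simp
  qed
  have "expectation (\<lambda>\<omega>. indicator A (T i \<omega>) * indicator A (Y i \<omega>) :: real)
      = expectation (\<lambda>\<omega>. expectation (\<lambda>\<omega>'. indicator A (T i \<omega>) * indicator A (Y i \<omega>')))"
    by (rule indep_var_decoupling_coordinate[OF ind, where C = 1])
       (use i in \<open>auto simp: indicator_def\<close>)
  also have "\<dots> = prob {\<omega>\<in>space M. T i \<omega> \<in> A} * prob {\<omega>\<in>space M. Y i \<omega> \<in> A}"
    by (simp add: e)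
  finally show ?thesis .
qed

lemma cdf_obs:
  assumes i: "1 \<le> i"
  shows "cdf (distr M borel (obs T Y i)) x = 1 - joint_survival x"
proof -
  note [measurable] = T_meas[OF i] Y_meas[OF i]
  have [measurable]: "obs T Y i \<in> borel_measurable M"
    unfolding obs_def[abs_def] by measurable
  have "prob {\<omega>\<in>space M. x < obs T Y i \<omega>} = expectation (indicator {\<omega>\<in>space M. x < obs T Y i \<omega>})"
    by simp
  also have "\<dots> = expectation (\<lambda>\<omega>. indicator {x<..} (T i \<omega>) * indicator {x<..} (Y i \<omega>))"
    by (intro Bochner_Integration.integral_cong) (auto simp: indicator_def obs_def)
  also have "\<dots> = joint_survival x"
    using expectation_indicator_pair[OF i, of "{x<..}"] T_law(7)[OF i i] Y_law(7)[OF i i]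
    by (simp add: joint_survival_def)
  finally have "prob {\<omega>\<in>space M. x < obs T Y i \<omega>} = joint_survival x" .
  moreover have "{\<omega>\<in>space M. obs T Y i \<omega> \<le> x} = space M - {\<omega>\<in>space M. x < obs T Y i \<omega>}" by auto
  moreover have "prob (space M - {\<omega>\<in>space M. x < obs T Y i \<omega>}) = 1 - prob {\<omega>\<in>space M. x < obs T Y i \<omega>}"
    by (rule prob_compl) auto
  moreover have "cdf (distr M borel (obs T Y i)) x = prob {\<omega>\<in>space M. obs T Y i \<omega> \<le> x}"
    unfolding cdf_def by (subst measure_distr) (auto intro!: arg_cong[where f = prob])
  ultimately show ?thesis by simp
qed

text \<open>
  The law of \<open>T i\<close> on the event that it is not censored, hence the mean of the empirical
  sub-distribution, see \<open>expectation_uncensored\<close>.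
\<close>

definition uncensored_law :: "real measure" where
  "uncensored_law = density lborel (\<lambda>x. ennreal (f x * (1 - G x)))"

lemma integral_uncensored_law:
  fixes v :: "real \<Rightarrow> real"
  assumes "v \<in> borel_measurable borel"
  shows "(\<integral>x. v x \<partial>uncensored_law) = (\<integral>x. f x * (1 - G x) * v x \<partial>lborel)"
  unfolding uncensored_law_def using assms f_nonneg G_cdf
  by (subst integral_real_density) auto

lemma expectation_uncensored:
  fixes v :: "real \<Rightarrow> real"
  assumes i: "1 \<le> i" and v[measurable]: "v \<in> borel_measurable borel" and bd: "\<And>x. \<bar>v x\<bar> \<le> C"
  shows "expectation (\<lambda>\<omega>. v (T i \<omega>) * of_bool (T i \<omega> \<le> Y i \<omega>)) = (\<integral>x. v x \<partial>uncensored_law)"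
proof -
  note [measurable] = T_meas[OF i] Y_meas[OF i]
  have C: "0 \<le> C" using bd[of 0] by linarith
  have inner: "expectation (\<lambda>\<omega>'. v t * of_bool (t \<le> Y i \<omega>')) = v t * (1 - G t)" for t
  proof -
    have "expectation (\<lambda>\<omega>'. of_bool (t \<le> Y i \<omega>') :: real) = expectation (indicator {\<omega>\<in>space M. t \<le> Y i \<omega>})"
      by (intro Bochner_Integration.integral_cong) (auto simp: indicator_def)
    then show ?thesis using Y_law(8)[OF i i] by simp
  qed
  have "expectation (\<lambda>\<omega>. v (T i \<omega>) * of_bool (T i \<omega> \<le> Y i \<omega>))
      = expectation (\<lambda>\<omega>. expectation (\<lambda>\<omega>'. v (T i \<omega>) * of_bool (T i \<omega> \<le> Y i \<omega>')))"
    by (rule indep_var_decoupling_coordinate[OF ind, where C = C])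
       (use i bd C in auto)
  also have "\<dots> = expectation (\<lambda>\<omega>. v (T i \<omega>) * (1 - G (T i \<omega>)))"
    unfolding inner ..
  also have "\<dots> = (\<integral>x. f x * (v x * (1 - G x)) \<partial>lborel)"
    by (rule distributed_integral[OF f[OF i], symmetric]) (use f_nonneg in auto)
  also have "\<dots> = (\<integral>x. v x \<partial>uncensored_law)"
    by (simp add: integral_uncensored_law mult_ac)
  finally show ?thesis .
qed

lemma f_mass: "(\<integral>\<^sup>+x. ennreal (f x) \<partial>lborel) = 1"
proof -
  have "emeasure M (T 1 -` UNIV \<inter> space M) = (\<integral>\<^sup>+x. ennreal (f x) * indicator UNIV x \<partial>lborel)"
    by (rule distributed_emeasure[OF f]) auto
  then show ?thesis by (simp add: emeasure_space_1)
qed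

lemma finite_borel_measure_density:
  assumes [measurable]: "d \<in> borel_measurable borel" and d: "\<And>x. d x \<le> K * f x" and K: "0 \<le> K"
  shows "finite_borel_measure (density lborel (\<lambda>x. ennreal (d x)))"
proof -
  have "(\<integral>\<^sup>+x. ennreal (d x) \<partial>lborel) \<le> (\<integral>\<^sup>+x. ennreal K * ennreal (f x) \<partial>lborel)"
    using d K f_nonneg by (intro nn_integral_mono) (auto simp: ennreal_leI simp flip: ennreal_mult)
  also have "\<dots> < \<infinity>"
    by (simp add: nn_integral_cmult f_mass)
  finally have "(\<integral>\<^sup>+x. ennreal (d x) \<partial>lborel) \<noteq> \<infinity>" by simp
  then show ?thesis
    by (intro finite_borel_measure.intro finite_measureI)
       (auto simp: finite_borel_measure_axioms_def emeasure_density)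
qed

lemma finite_uncensored_law: "finite_borel_measure uncensored_law"
  unfolding uncensored_law_def
proof (rule finite_borel_measure_density[where K = 1])
  show "f x * (1 - G x) \<le> 1 * f x" for x
    using mult_left_mono[of "1 - G x" 1 "f x"] f_nonneg G_cdf by simp
qed auto

sublocale uncensored_law: finite_borel_measure uncensored_law
  by (rule finite_uncensored_law)

lemma isCont_cdf_uncensored_law: "isCont (cdf uncensored_law) x"
proof -
  have "emeasure uncensored_law {x} = 0"
    unfolding uncensored_law_def using AE_lborel_singleton[of x]
    by (subst emeasure_density) (auto intro!: nn_integral_zero' elim: eventually_mono)
  then show ?thesis by (simp add: uncensored_law.isCont_cdf measure_def)
qed

lemma cdf_uncensored_law:
  "1 \<le> i \<Longrightarrow> cdf uncensored_law x = expectation (\<lambda>\<omega>. of_bool (T i \<omega> \<le> x \<and> T i \<omega> \<le> Y i \<omega>))"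
proof -
  assume i: "1 \<le> i"
  have "expectation (\<lambda>\<omega>. indicator {..x} (T i \<omega>) * of_bool (T i \<omega> \<le> Y i \<omega>) :: real) = (\<integral>z. indicator {..x} z \<partial>uncensored_law)"
    by (rule expectation_uncensored[OF i, where C = 1]) (auto simp: indicator_def)
  moreover have "(\<integral>z. indicator {..x} z \<partial>uncensored_law) = cdf uncensored_law x"
    by (simp add: cdf_def uncensored_law.borel_UNIV)
  ultimately show ?thesis by (simp add: indicator_def of_bool_conj)
qed

lemma cdf_uncensored_law_negative: "x < 0 \<Longrightarrow> cdf uncensored_law x = 0"
proof -
  assume x: "x < 0"
  have "expectation (\<lambda>\<omega>. of_bool (T 1 \<omega> \<le> x \<and> T 1 \<omega> \<le> Y 1 \<omega>)) = expectation (\<lambda>_. 0)"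
    using T_nonneg[of 1] x by (intro Bochner_Integration.integral_cong) fastforce+
  then show ?thesis by (simp add: cdf_uncensored_law[of 1])
qed

text \<open>
  The tail bound and the grid argument combined, for averages of a function of each pair that is
  monotone in the pair, as negative association demands, and in the parameter \<open>x\<close>, as the grid
  demands.
\<close>

lemma average_uniform_rate:
  fixes \<phi> :: "real \<Rightarrow> real \<Rightarrow> real \<Rightarrow> real" and c :: real
  assumes c: "0 \<le> c"
    and mon: "\<And>x. coordinatewise_monotone (\<phi> x)"
    and meas: "\<And>x. (\<lambda>z. \<phi> x (fst z) (snd z)) \<in> borel_measurable (borel \<Otimes>\<^sub>M borel)"
    and bd: "\<And>x t y. 0 \<le> \<phi> x t y" "\<And>x t y. \<phi> x t y \<le> 1"
    and inc: "\<And>x x' t y. x \<le> x' \<Longrightarrow> \<phi> x t y \<le> \<phi> x' t y"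
    and m: "\<And>x i. 1 \<le> i \<Longrightarrow> expectation (\<lambda>\<omega>. \<phi> x (T i \<omega>) (Y i \<omega>)) = m x"
    and cont: "\<And>x. isCont m x" and mono_m: "mono m"
  shows "\<exists>K. 0 \<le> K \<and> (AE \<omega> in M. \<forall>\<^sub>F n in sequentially.
    \<forall>x\<in>{0..c}. \<bar>(\<Sum>i\<in>{1..n}. \<phi> x (T i \<omega>) (Y i \<omega>)) / real n - m x\<bar> \<le> K * sqrt (ln (real n) / real n))"
proof (rule monotone_average_uniform_rate[OF c _ _ _ mono_m])
  have [measurable]: "(\<lambda>\<omega>. \<phi> x (T i \<omega>) (Y i \<omega>)) \<in> borel_measurable M" if "1 \<le> i" for x i
    using neg_assoc_pair_measurable[OF na _ meas] that by auto
  show "(\<lambda>\<omega>. (\<Sum>i\<in>{1..n}. \<phi> x (T i \<omega>) (Y i \<omega>)) / real n) \<in> borel_measurable M" for n x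
    by (intro borel_measurable_divide borel_measurable_sum) auto
  show "(\<Sum>i\<in>{1..n}. \<phi> x (T i \<omega>) (Y i \<omega>)) / real n \<le> (\<Sum>i\<in>{1..n}. \<phi> x' (T i \<omega>) (Y i \<omega>)) / real n"
    if "x \<le> x'" for n \<omega> x x'
    using inc[OF that] by (intro divide_right_mono sum_mono) auto
  show "continuous_on {0..c} m"
    using cont by (simp add: continuous_at_imp_continuous_on)
  show "prob {\<omega>\<in>space M. \<epsilon> \<le> \<bar>(\<Sum>i\<in>{1..n}. \<phi> x (T i \<omega>) (Y i \<omega>)) / real n - m x\<bar>} \<le> 2 * exp (- 2 * real n * \<epsilon>\<^sup>2)"
    if "1 \<le> n" "0 < \<epsilon>" for n x \<epsilon>
    using neg_assoc_pair_tail[OF na ind _ _ _ mon meas bd m that(2), of "{1..n}" x] that by auto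
qed

text \<open>
  On the negative half-line the empirical and the true function both vanish, so the rate on
  \<open>{0..c}\<close> is a rate on \<open>{..c}\<close>.
\<close>

lemma sub_edf_uniform_rate:
  assumes c: "0 \<le> c"
  shows "\<exists>K. 0 \<le> K \<and> (AE \<omega> in M. \<forall>\<^sub>F n in sequentially.
    cdf_close (interval_measure (sub_edf T Y n \<omega>)) uncensored_law c (K * sqrt (ln (real n) / real n)))"
proof -
  let ?\<phi> = "\<lambda>x t y. of_bool (t \<le> x \<and> t \<le> y) :: real"
  have "\<exists>K. 0 \<le> K \<and> (AE \<omega> in M. \<forall>\<^sub>F n in sequentially. \<forall>x\<in>{0..c}.
    \<bar>(\<Sum>i\<in>{1..n}. ?\<phi> x (T i \<omega>) (Y i \<omega>)) / real n - cdf uncensored_law x\<bar> \<le> K * sqrt (ln (real n) / real n))"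
  proof (rule average_uniform_rate[OF c])
    show "coordinatewise_monotone (?\<phi> x)" for x
    proof -
      have "\<forall>t. mono (?\<phi> x t)" "\<forall>y. antimono (\<lambda>t. ?\<phi> x t y)"
        by (auto simp: mono_def antimono_def)
      then show ?thesis by (auto simp: coordinatewise_monotone_def comonotone_family_def)
    qed
    show "expectation (\<lambda>\<omega>. ?\<phi> x (T i \<omega>) (Y i \<omega>)) = cdf uncensored_law x" if "1 \<le> i" for x i
      using cdf_uncensored_law[OF that] by simp
    show "mono (cdf uncensored_law)"
      using uncensored_law.cdf_nondecreasing by (auto simp: mono_def)
  qed (auto intro: isCont_cdf_uncensored_law)
  then obtain K where K: "0 \<le> K" and AE: "AE \<omega> in M. \<forall>\<^sub>F n in sequentially. \<forall>x\<in>{0..c}.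
    \<bar>(\<Sum>i\<in>{1..n}. ?\<phi> x (T i \<omega>) (Y i \<omega>)) / real n - cdf uncensored_law x\<bar> \<le> K * sqrt (ln (real n) / real n)"
    by blast
  have "AE \<omega> in M. \<forall>\<^sub>F n in sequentially.
    cdf_close (interval_measure (sub_edf T Y n \<omega>)) uncensored_law c (K * sqrt (ln (real n) / real n))"
    using AE AE_space
  proof eventually_elim
    case (elim \<omega>)
    show ?case
      using elim(1) eventually_ge_at_top[of 1]
    proof eventually_elim
      case (elim n)
      let ?e = "K * sqrt (ln (real n) / real n)"
      have e0: "0 \<le> ?e" using K elim by auto
      have sub: "sub_edf T Y n \<omega> x = (\<Sum>i\<in>{1..n}. ?\<phi> x (T i \<omega>) (Y i \<omega>)) / real n" for x
        unfolding sub_edf_eq sum.inter_filter[OF finite_atLeastAtMost] sum_divide_distrib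
        by (intro sum.cong) (auto simp: obs_def uncensored_def)
      have "\<bar>sub_edf T Y n \<omega> x - cdf uncensored_law x\<bar> \<le> ?e" if "x \<le> c" for x
      proof (cases "0 \<le> x")
        case True
        then show ?thesis using elim that unfolding sub by auto
      next
        case False
        then have "?\<phi> x (T i \<omega>) (Y i \<omega>) = 0" if "i \<in> {1..n}" for i
          using T_nonneg[of i \<omega>] that \<open>\<omega> \<in> space M\<close> by auto
        then have "sub_edf T Y n \<omega> x = 0" unfolding sub by (subst sum.neutral) auto
        then show ?thesis using e0 False by (simp add: cdf_uncensored_law_negative)
      qed
      moreover have "finite_borel_measure (interval_measure (sub_edf T Y n \<omega>))"
        "\<And>x. cdf (interval_measure (sub_edf T Y n \<omega>)) x = sub_edf T Y n \<omega> x"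
        by (rule finite_borel_measure_step_function[OF _ _ sub_edf_eq]
            cdf_interval_measure_step_function[OF _ _ sub_edf_eq]; simp)+
      ultimately show ?case
        using finite_uncensored_law by (auto simp: cdf_close_def)
    qed
  qed
  then show ?thesis using K by blast
qed

text \<open>
  The grid argument is for increasing functions, so it is applied to the proportion of those no
  longer at risk.
\<close>

lemma at_risk_uniform_rate:
  assumes c: "0 \<le> c"
  shows "\<exists>K. 0 \<le> K \<and> (AE \<omega> in M. \<forall>\<^sub>F n in sequentially. \<forall>x\<le>c.
    \<bar>real (at_risk T Y n \<omega> x) / real n - joint_survival x\<bar> \<le> K * sqrt (ln (real n) / real n))"
proof -
  let ?\<phi> = "\<lambda>x t y. of_bool (t < x \<or> y < x) :: real"
  have "\<exists>K. 0 \<le> K \<and> (AE \<omega> in M. \<forall>\<^sub>F n in sequentially. \<forall>x\<in>{0..c}.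
    \<bar>(\<Sum>i\<in>{1..n}. ?\<phi> x (T i \<omega>) (Y i \<omega>)) / real n - (1 - joint_survival x)\<bar> \<le> K * sqrt (ln (real n) / real n))"
  proof (rule average_uniform_rate[OF c])
    show "coordinatewise_monotone (?\<phi> x)" for x
    proof -
      have "\<forall>t. antimono (?\<phi> x t)" "\<forall>y. antimono (\<lambda>t. ?\<phi> x t y)"
        by (auto simp: antimono_def)
      then show ?thesis by (auto simp: coordinatewise_monotone_def comonotone_family_def)
    qed
    show "expectation (\<lambda>\<omega>. ?\<phi> x (T i \<omega>) (Y i \<omega>)) = 1 - joint_survival x" if i: "1 \<le> i" for x i
    proof -
      note [measurable] = T_meas[OF i] Y_meas[OF i]
      have "expectation (\<lambda>\<omega>. ?\<phi> x (T i \<omega>) (Y i \<omega>))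
          = expectation (\<lambda>\<omega>. 1 - indicator {x..} (T i \<omega>) * indicator {x..} (Y i \<omega>))"
        by (intro Bochner_Integration.integral_cong) (auto simp: indicator_def)
      also have "\<dots> = 1 - expectation (\<lambda>\<omega>. indicator {x..} (T i \<omega>) * indicator {x..} (Y i \<omega>))"
      proof -
        have "integrable M (\<lambda>\<omega>. indicator {x..} (T i \<omega>) * indicator {x..} (Y i \<omega>) :: real)"
          by (rule integrable_bounded_nonneg[where C = 1]) (auto simp: indicator_def)
        then show ?thesis by (simp add: prob_space)
      qed
      also have "\<dots> = 1 - joint_survival x"
        using expectation_indicator_pair[OF i, of "{x..}"] T_law(8)[OF i i] Y_law(8)[OF i i]
        by (simp add: joint_survival_def)
      finally show ?thesis .
    qed
    show "mono (\<lambda>x. 1 - joint_survival x)"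
      using joint_survival_antimono by (auto simp: mono_def antimono_def)
    show "isCont (\<lambda>x. 1 - joint_survival x) x" for x
      by (intro continuous_intros isCont_joint_survival)
  qed auto
  then obtain K where K: "0 \<le> K" and AE: "AE \<omega> in M. \<forall>\<^sub>F n in sequentially. \<forall>x\<in>{0..c}.
    \<bar>(\<Sum>i\<in>{1..n}. ?\<phi> x (T i \<omega>) (Y i \<omega>)) / real n - (1 - joint_survival x)\<bar> \<le> K * sqrt (ln (real n) / real n)"
    by blast
  have "AE \<omega> in M. \<forall>\<^sub>F n in sequentially. \<forall>x\<le>c.
    \<bar>real (at_risk T Y n \<omega> x) / real n - joint_survival x\<bar> \<le> K * sqrt (ln (real n) / real n)"
    using AE AE_space
  proof eventually_elim
    case (elim \<omega>)
    show ?case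
      using elim(1) eventually_ge_at_top[of 1]
    proof eventually_elim
      case (elim n)
      let ?e = "K * sqrt (ln (real n) / real n)"
      have e0: "0 \<le> ?e" using K elim by auto
      have n: "real n \<noteq> 0" using elim by simp
      have risk: "real (at_risk T Y n \<omega> x) / real n = 1 - (\<Sum>i\<in>{1..n}. ?\<phi> x (T i \<omega>) (Y i \<omega>)) / real n" for x
      proof -
        have "real (at_risk T Y n \<omega> x) = (\<Sum>i\<in>{1..n}. if x \<le> obs T Y i \<omega> then 1 else 0)"
          unfolding at_risk_def by (subst sum.inter_filter[symmetric]) auto
        also have "\<dots> = (\<Sum>i\<in>{1..n}. 1 - ?\<phi> x (T i \<omega>) (Y i \<omega>))"
          by (intro sum.cong) (auto simp: obs_def)
        also have "\<dots> = real n - (\<Sum>i\<in>{1..n}. ?\<phi> x (T i \<omega>) (Y i \<omega>))"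
          unfolding sum_subtractf by simp
        finally show ?thesis using n by (simp add: diff_divide_distrib)
      qed
      show ?case
      proof (intro allI impI)
        fix x assume "x \<le> c"
        show "\<bar>real (at_risk T Y n \<omega> x) / real n - joint_survival x\<bar> \<le> ?e"
        proof (cases "0 \<le> x")
          case True
          then have "\<bar>(\<Sum>i\<in>{1..n}. ?\<phi> x (T i \<omega>) (Y i \<omega>)) / real n - (1 - joint_survival x)\<bar> \<le> ?e"
            using elim \<open>x \<le> c\<close> by auto
          then show ?thesis unfolding risk by linarith
        next
          case False
          then have "?\<phi> x (T i \<omega>) (Y i \<omega>) = 0" if "i \<in> {1..n}" for i
            using T_nonneg[of i \<omega>] Y_nonneg[of i \<omega>] that \<open>\<omega> \<in> space M\<close> by auto
          then have "(\<Sum>i\<in>{1..n}. ?\<phi> x (T i \<omega>) (Y i \<omega>)) = 0" by (intro sum.neutral) auto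
          then show ?thesis using e0 False unfolding risk by (simp add: joint_survival_negative)
        qed
      qed
    qed
  qed
  then show ?thesis using K by blast
qed

section \<open>The hazard and the kernel smoothing error\<close>

text \<open>
  The measure \<open>hazard_measure f F\<close> cut off at \<open>c\<close>: its total mass may be infinite, but it is finite on
  \<open>{..c}\<close> when \<open>F c < 1\<close>.
\<close>

definition hazard_law :: "real \<Rightarrow> real measure" where
  "hazard_law c = density lborel (\<lambda>x. ennreal (indicator {0..c} x * hazard f F x))"

lemma hazard_measurable[measurable]: "hazard f F \<in> borel_measurable borel"
  unfolding hazard_def[abs_def] by measurable

lemma hazard_nonneg: "0 \<le> hazard f F x"
  using f_nonneg F_cdf by (simp add: hazard_def)

lemma joint_survival_pos:
  assumes "0 < joint_survival c" "x \<le> c"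
  shows "F x < 1" "G x < 1"
proof -
  have "F c < 1" "G c < 1"
    using assms(1) F_cdf(4)[of c] G_cdf(4)[of c] by (auto simp: joint_survival_def zero_less_mult_iff)
  then show "F x < 1" "G x < 1"
    using monoD[OF F_cdf(2) assms(2)] monoD[OF G_cdf(2) assms(2)] by auto
qed

lemma finite_hazard_law:
  assumes "0 < joint_survival c"
  shows "finite_borel_measure (hazard_law c)"
  unfolding hazard_law_def
proof (rule finite_borel_measure_density[where K = "1 / (1 - F c)"])
  have Fc: "F c < 1" by (rule joint_survival_pos[OF assms]) simp
  then show "0 \<le> 1 / (1 - F c)" by simp
  show "indicator {0..c} x * hazard f F x \<le> 1 / (1 - F c) * f x" for x
  proof (cases "x \<in> {0..c}")
    case True
    then have "f x / (1 - F x) \<le> f x / (1 - F c)"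
      using monoD[OF F_cdf(2), of x c] Fc f_nonneg by (intro divide_left_mono) auto
    then show ?thesis using True by (simp add: hazard_def)
  qed (use Fc f_nonneg in simp)
qed simp

lemma integral_hazard_law:
  fixes v :: "real \<Rightarrow> real"
  assumes "v \<in> borel_measurable borel"
  shows "(\<integral>x. v x \<partial>hazard_law c) = (\<integral>x. indicator {0..c} x * hazard f F x * v x \<partial>lborel)"
  unfolding hazard_law_def using assms hazard_nonneg
  by (subst integral_real_density) auto

text \<open>
  The censoring cancels: the uncensored law has density \<open>f * (1 - G)\<close>, and dividing by
  \<open>(1 - F) * (1 - G)\<close> leaves the hazard.
\<close>

lemma cdf_hazard_law:
  assumes c: "0 < joint_survival c" and x: "x \<le> c"
  shows "cdf (hazard_law c) x = (\<integral>z. indicator {..x} z / joint_survival z \<partial>uncensored_law)"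
proof -
  interpret finite_borel_measure "hazard_law c" by (rule finite_hazard_law[OF c])
  have [measurable]: "joint_survival \<in> borel_measurable borel"
    unfolding joint_survival_def[abs_def] by measurable
  have "cdf (hazard_law c) x = (\<integral>z. indicator {..x} z \<partial>hazard_law c)"
    by (simp add: cdf_def borel_UNIV)
  also have "\<dots> = (\<integral>z. indicator {0..c} z * hazard f F z * indicator {..x} z \<partial>lborel)"
    by (rule integral_hazard_law) simp
  also have "\<dots> = (\<integral>z. f z * (1 - G z) * (indicator {..x} z / joint_survival z) \<partial>lborel)"
  proof (rule integral_cong_AE)
    show "AE z in lborel. indicator {0..c} z * hazard f F z * indicator {..x} z
        = f z * (1 - G z) * (indicator {..x} z / joint_survival z)"
      using f_negative
    proof eventually_elim
      case (elim z)
      then show ?case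
        using x joint_survival_pos[OF c, of z]
        by (auto simp: indicator_def hazard_def joint_survival_def)
    qed
  qed simp_all
  also have "\<dots> = (\<integral>z. indicator {..x} z / joint_survival z \<partial>uncensored_law)"
    by (rule integral_uncensored_law[symmetric]) simp
  finally show ?thesis .
qed

text \<open>
  A kernel centred at \<open>t\<close> with bandwidth \<open>h\<close> does not reach beyond \<open>t - r * h\<close>, so the cut-off at \<open>c\<close> is
  invisible to it.
\<close>

lemma kernel_smooth_hazard_law:
  assumes k[measurable]: "k \<in> borel_measurable borel" and k0: "\<And>u. u \<le> r \<Longrightarrow> k u = 0"
    and h: "0 < h" and t: "t - r * h \<le> c"
  shows "kernel_smooth k h a (hazard_measure f F) t = kernel_smooth k h a (hazard_law c) t"
proof -
  have van: "k ((t - x) / h) = 0" if "c < x" for x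
    using that h t by (intro k0) (simp add: pos_divide_le_eq)
  have "(LINT x:{a..}|hazard_measure f F. k ((t - x) / h))
      = (\<integral>x. indicator {0..} x * hazard f F x * (indicator {a..} x * k ((t - x) / h)) \<partial>lborel)"
    unfolding set_lebesgue_integral_def hazard_measure_def using hazard_nonneg
    by (subst integral_real_density) auto
  also have "\<dots> = (\<integral>x. indicator {0..c} x * hazard f F x * (indicator {a..} x * k ((t - x) / h)) \<partial>lborel)"
    using van by (intro Bochner_Integration.integral_cong) (auto simp: indicator_def)
  also have "\<dots> = (LINT x:{a..}|hazard_law c. k ((t - x) / h))"
    unfolding set_lebesgue_integral_def real_scaleR_def by (rule integral_hazard_law[symmetric]) measurable
  finally show ?thesis by (simp add: kernel_smooth_def)
qed

text \<open>
  For fixed \<open>t\<close> the estimator is an average of one bounded function over the uncensored lifetimes, so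
  its mean is the smoothed uncensored law.
\<close>

lemma expectation_sub_density_est:
  assumes n: "1 \<le> n" and k[measurable]: "k \<in> borel_measurable borel" and bd: "\<And>u. \<bar>k u\<bar> \<le> C"
  shows "expectation (\<lambda>\<omega>. sub_density_est T Y F k b n \<omega> t)
    = kernel_smooth k (b n) (lower_endpoint F) uncensored_law t"
proof -
  define v where "v x = indicator {lower_endpoint F..} x * k ((t - x) / b n)" for x
  have v[measurable]: "v \<in> borel_measurable borel" unfolding v_def[abs_def] by measurable
  have C: "0 \<le> C" using bd[of 0] by linarith
  have v_bd: "\<bar>v x\<bar> \<le> C" for x using bd C by (simp add: v_def indicator_def)
  let ?v = "\<lambda>i \<omega>. v (T i \<omega>) * of_bool (T i \<omega> \<le> Y i \<omega>)"
  have est: "sub_density_est T Y F k b n \<omega> t = inverse (b n) * ((\<Sum>i\<in>{1..n}. ?v i \<omega>) / real n)" for \<omega>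
  proof -
    have "(\<integral>x. v x \<partial>interval_measure (sub_edf T Y n \<omega>))
        = (\<Sum>i\<in>{i\<in>{1..n}. uncensored T Y i \<omega>}. 1 / real n * v (obs T Y i \<omega>))"
      by (rule integral_interval_measure_step_function[OF _ _ sub_edf_eq]) auto
    also have "\<dots> = (\<Sum>i\<in>{1..n}. ?v i \<omega>) / real n"
      unfolding sum.inter_filter[OF finite_atLeastAtMost] sum_divide_distrib
      by (intro sum.cong) (auto simp: obs_def uncensored_def)
    finally show ?thesis
      by (simp add: sub_density_est_def kernel_smooth_def set_lebesgue_integral_def v_def[symmetric])
  qed
  have int: "integrable M (?v i)" if "i \<in> {1..n}" for i
  proof (rule integrable_const_bound[where B = C])
    have i: "1 \<le> i" using that by simp
    note [measurable] = T_meas[OF i] Y_meas[OF i]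
    show "?v i \<in> borel_measurable M" by measurable
  qed (use v_bd C in auto)
  have "expectation (\<lambda>\<omega>. sub_density_est T Y F k b n \<omega> t)
      = inverse (b n) * ((\<Sum>i\<in>{1..n}. expectation (?v i)) / real n)"
    unfolding est
    by (simp only: integral_mult_right_zero integral_divide_zero Bochner_Integration.integral_sum[OF int])
  also have "(\<Sum>i\<in>{1..n}. expectation (?v i)) = (\<Sum>i\<in>{1..n}. \<integral>x. v x \<partial>uncensored_law)"
    by (intro sum.cong refl expectation_uncensored[OF _ v v_bd]) simp
  finally show ?thesis
    using n by (simp add: kernel_smooth_def set_lebesgue_integral_def v_def)
qed

text \<open>
  On the event where both empirical rates hold, the two kernel errors are bounded one by one by the
  smoothing inequality; the second is divided by a survival probability that is at least its value
  at \<open>c\<close>.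
\<close>

lemma kernel_error_rate:
  assumes c: "0 \<le> c" "0 < joint_survival c" and \<tau>: "\<tau> < c"
    and k: "k \<in> borel_measurable borel" and bv: "bounded_variation_on {r<..<s} k"
    and k0: "\<And>t. t \<notin> {r<..<s} \<Longrightarrow> k t = 0"
    and b: "\<And>n. 1 \<le> n \<Longrightarrow> 0 < b n" "b \<longlonglongrightarrow> 0"
  shows "\<exists>K. 0 \<le> K \<and> (AE \<omega> in M. \<forall>\<^sub>F n in sequentially. \<forall>t\<le>\<tau>.
    \<bar>hazard_est T Y F k b n \<omega> t - smoothed_hazard f F k b n t
      - (sub_density_est T Y F k b n \<omega> t - expectation (\<lambda>\<omega>'. sub_density_est T Y F k b n \<omega>' t))
        / joint_survival t\<bar>
    \<le> K * (inverse (b n) * sqrt (ln (real n) / real n)))"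
proof -
  let ?e = "\<lambda>n. sqrt (ln (real n) / real n)" and ?a = "lower_endpoint F"
  let ?\<beta> = "joint_survival c"
  obtain K1 where K1: "0 \<le> K1" "AE \<omega> in M. \<forall>\<^sub>F n in sequentially.
      cdf_close (interval_measure (sub_edf T Y n \<omega>)) uncensored_law c (K1 * ?e n)"
    using sub_edf_uniform_rate[OF c(1)] by blast
  obtain K2 where K2: "0 \<le> K2" "AE \<omega> in M. \<forall>\<^sub>F n in sequentially. \<forall>x\<le>c.
      \<bar>real (at_risk T Y n \<omega> x) / real n - joint_survival x\<bar> \<le> K2 * ?e n"
    using at_risk_uniform_rate[OF c(1)] by blast
  obtain C where C: "0 \<le> C" "\<And>\<mu> \<nu> c \<epsilon> a h t. cdf_close \<mu> \<nu> c \<epsilon> \<Longrightarrow> 0 < h \<Longrightarrow> t - r * h \<le> c \<Longrightarrow>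
      \<bar>(LINT x:{a..}|\<mu>. k ((t - x) / h)) - (LINT x:{a..}|\<nu>. k ((t - x) / h))\<bar> \<le> C * \<epsilon>"
    using cdf_close_kernel_integral[OF bv k0] by blast
  obtain B where B: "\<And>u. \<bar>k u\<bar> \<le> B"
    using bounded_variation_bounded[OF bv k0] by blast
  define K where "K = max K1 K2"
  define Q where "Q = 2 / ?\<beta>\<^sup>2 + 2 / ?\<beta>"
  have Q: "0 \<le> Q" using c by (simp add: Q_def)
  have K: "0 \<le> K" using K1 by (simp add: K_def)
  have e_lim: "(\<lambda>n. K * ?e n) \<longlonglongrightarrow> 0"
    using tendsto_mult_left[OF tendsto_real_sqrt[OF lim_ln_over_n], of K] by simp
  have e_small: "\<forall>\<^sub>F n in sequentially. K * ?e n \<le> ?\<beta> / 2"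
    using order_tendstoD(2)[OF e_lim, of "?\<beta> / 2"] c by (auto elim: eventually_mono)
  have b_small: "\<forall>\<^sub>F n in sequentially. - r * b n < c - \<tau>"
    using order_tendstoD(2)[OF tendsto_mult_left[OF b(2), of "- r"], of "c - \<tau>"] \<tau> by simp
  have "AE \<omega> in M. \<forall>\<^sub>F n in sequentially. \<forall>t\<le>\<tau>.
    \<bar>hazard_est T Y F k b n \<omega> t - smoothed_hazard f F k b n t
      - (sub_density_est T Y F k b n \<omega> t - expectation (\<lambda>\<omega>'. sub_density_est T Y F k b n \<omega>' t))
        / joint_survival t\<bar>
    \<le> C * (Q + 1 / ?\<beta>) * K * (inverse (b n) * ?e n)"
    using K1(2) K2(2)
  proof eventually_elim
    case (elim \<omega>)
    show ?case
      using elim e_small b_small eventually_ge_at_top[of 1]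
    proof eventually_elim
      case (elim n)
      let ?h = "b n" and ?\<epsilon> = "K * ?e n"
      have n: "1 \<le> n" and h: "0 < ?h" using elim b by auto
      have e0: "0 \<le> ?e n" using n by simp
      have K1e: "K1 * ?e n \<le> ?\<epsilon>" and K2e: "K2 * ?e n \<le> ?\<epsilon>"
        by (intro mult_right_mono e0; simp add: K_def)+
      have A: "cdf_close (interval_measure (sub_edf T Y n \<omega>)) uncensored_law c ?\<epsilon>"
        using elim(1) K1e unfolding cdf_close_def by (auto intro: order.trans)
      have H: "cdf_close (interval_measure (cum_hazard_est T Y n \<omega>)) (hazard_law c) c (Q * ?\<epsilon>)"
        unfolding Q_def
      proof (rule cum_hazard_est_cdf_close[OF n A])
        show "\<bar>real (at_risk T Y n \<omega> x) / real n - joint_survival x\<bar> \<le> ?\<epsilon>" if "x \<le> c" for x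
          using elim(2) K2e that by (auto intro: order.trans)
      qed (use joint_survival_antimono c elim finite_hazard_law cdf_hazard_law in auto)
      show ?case
      proof (intro allI impI)
        fix t assume t: "t \<le> \<tau>"
        then have tc: "t - r * ?h \<le> c" using elim by simp
        have "t \<le> c" using t \<tau> by simp
        then have St: "?\<beta> \<le> joint_survival t" using joint_survival_antimono by (auto simp: antimono_def)
        let ?I = "\<lambda>\<mu>. LINT x:{?a..}|\<mu>. k ((t - x) / ?h)"
        let ?u = "hazard_est T Y F k b n \<omega> t - smoothed_hazard f F k b n t"
        let ?v = "sub_density_est T Y F k b n \<omega> t - expectation (\<lambda>\<omega>'. sub_density_est T Y F k b n \<omega>' t)"
        have "?u = inverse ?h * (?I (interval_measure (cum_hazard_est T Y n \<omega>)) - ?I (hazard_law c))"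
          unfolding hazard_est_def smoothed_hazard_def
          using kernel_smooth_hazard_law[OF k, of r ?h t c] k0 h tc
          by (simp add: kernel_smooth_def right_diff_distrib)
        then have u: "\<bar>?u\<bar> \<le> inverse ?h * (C * (Q * ?\<epsilon>))"
          using C(2)[OF H h tc, of ?a] h by (simp add: abs_mult mult_left_mono del: inverse_eq_divide)
        have "?v = inverse ?h * (?I (interval_measure (sub_edf T Y n \<omega>)) - ?I uncensored_law)"
          unfolding expectation_sub_density_est[OF n k B]
          by (simp add: sub_density_est_def kernel_smooth_def right_diff_distrib)
        then have v: "\<bar>?v\<bar> \<le> inverse ?h * (C * ?\<epsilon>)"
          using C(2)[OF A h tc, of ?a] h by (simp add: abs_mult mult_left_mono del: inverse_eq_divide)
        have "\<bar>?v / joint_survival t\<bar> = \<bar>?v\<bar> / joint_survival t"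
          using St c by (simp add: abs_divide)
        also have "\<dots> \<le> (inverse ?h * (C * ?\<epsilon>)) / ?\<beta>"
          using v St c by (intro frac_le) auto
        finally have "\<bar>?u - ?v / joint_survival t\<bar> \<le> inverse ?h * (C * (Q * ?\<epsilon>)) + (inverse ?h * (C * ?\<epsilon>)) / ?\<beta>"
          using u abs_triangle_ineq4[of ?u "?v / joint_survival t"] by linarith
        also have "\<dots> = C * (Q + 1 / ?\<beta>) * K * (inverse ?h * ?e n)"
          by (simp add: algebra_simps)
        finally show "\<bar>?u - ?v / joint_survival t\<bar> \<le> C * (Q + 1 / ?\<beta>) * K * (inverse ?h * ?e n)" .
      qed
    qed
  qed
  moreover have "0 \<le> C * (Q + 1 / ?\<beta>) * K"
    using C(1) Q K c by simp
  ultimately show ?thesis by blast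
qed

end

text \<open>
  Non-emptiness of \<open>S\<close> matters: the supremum over the empty set is \<open>- \<infinity>\<close>, whose absolute value is
  infinite.
\<close>

lemma bigo_as_SUP:
  fixes Z :: "nat \<Rightarrow> 'a \<Rightarrow> real \<Rightarrow> real" and a :: "nat \<Rightarrow> real"
  assumes S: "S \<noteq> {}" and a: "\<forall>\<^sub>F n in sequentially. 0 < a n"
    and AE: "AE \<omega> in M. \<forall>\<^sub>F n in sequentially. \<forall>t\<in>S. \<bar>Z n \<omega> t\<bar> \<le> K * a n"
  shows "bigo_as M (\<lambda>n \<omega>. SUP t\<in>S. ereal \<bar>Z n \<omega> t\<bar>) a"
  unfolding bigo_as_def using AE
proof eventually_elim
  case (elim \<omega>)
  have "\<forall>\<^sub>F n in sequentially. \<bar>SUP t\<in>S. ereal \<bar>Z n \<omega> t\<bar>\<bar> / ereal (a n) \<le> ereal K"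
    using elim a
  proof eventually_elim
    case (elim n)
    let ?s = "SUP t\<in>S. ereal \<bar>Z n \<omega> t\<bar>"
    obtain t0 where "t0 \<in> S" using S by auto
    then have "0 \<le> ?s" by (intro SUP_upper2[of t0]) auto
    moreover have "?s \<le> ereal (K * a n)" using elim by (intro SUP_least) auto
    ultimately have "\<bar>?s\<bar> / ereal (a n) \<le> ereal (K * a n) / ereal (a n)"
      using elim by (intro ereal_divide_right_mono) auto
    also have "\<dots> = ereal K" using elim by simp
    finally show ?case .
  qed
  then have "limsup (\<lambda>n. \<bar>SUP t\<in>S. ereal \<bar>Z n \<omega> t\<bar>\<bar> / ereal (a n)) \<le> ereal K"
    by (rule Limsup_bounded)
  then show ?case by (auto intro: le_less_trans)
qed

theorem theorem2:
  fixes M :: "'a measure" and T Y :: "nat \<Rightarrow> 'a \<Rightarrow> real"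
    and F f G g L k :: "real \<Rightarrow> real" and r s \<tau> :: real and b :: "nat \<Rightarrow> real"
  assumes "prob_space M"
    and "\<And>i \<omega>. 1 \<le> i \<Longrightarrow> \<omega> \<in> space M \<Longrightarrow> 0 \<le> T i \<omega>"
    and "\<And>i \<omega>. 1 \<le> i \<Longrightarrow> \<omega> \<in> space M \<Longrightarrow> 0 \<le> Y i \<omega>"
    and "neg_assoc M {1..} T" and "neg_assoc M {1..} Y"
    and "prob_space.indep_var M
           (PiM {1..} (\<lambda>_. borel)) (\<lambda>\<omega>. \<lambda>i\<in>{1..}. T i \<omega>)
           (PiM {1..} (\<lambda>_. borel)) (\<lambda>\<omega>. \<lambda>i\<in>{1..}. Y i \<omega>)"
    and "\<And>i. 1 \<le> i \<Longrightarrow> cdf (distr M borel (T i)) = F"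
    and "continuous_on UNIV F"
    and "\<And>x. 0 \<le> f x"
    and "\<And>i. 1 \<le> i \<Longrightarrow> distributed M lborel (T i) (\<lambda>x. ennreal (f x))"
    and "\<And>i. 1 \<le> i \<Longrightarrow> cdf (distr M borel (Y i)) = G"
    and "\<And>x. 0 \<le> g x"
    and "\<And>i. 1 \<le> i \<Longrightarrow> distributed M lborel (Y i) (\<lambda>x. ennreal (g x))"
    and "AE x in lborel. (G has_real_derivative g x) (at x)"
    and "\<And>i. 1 \<le> i \<Longrightarrow> cdf (distr M borel (obs T Y i)) = L"
    and "probability_kernel k"
    and "r < 0" and "0 < s"
    and "bounded_variation_on {r<..<s} k"
    and "\<And>t. t \<notin> {r<..<s} \<Longrightarrow> k t = 0"
    and "lower_endpoint F < \<tau>" and "ereal \<tau> < upper_endpoint L"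
    and "bounded (f ` {0..\<tau>})" and "bounded (g ` {0..\<tau>})"
    and "\<And>n. 1 \<le> n \<Longrightarrow> 0 < b n"
    and "b \<longlonglongrightarrow> 0"
    and "(\<lambda>n. inverse (b n)) \<in> o(\<lambda>n. sqrt (real n / ln (real n)))"
  shows "bigo_as M
           (\<lambda>n \<omega>. SUP t\<in>{0<..\<tau>}.
              ereal \<bar>hazard_est T Y F k b n \<omega> t - smoothed_hazard f F k b n t
                - (sub_density_est T Y F k b n \<omega> t
                    - prob_space.expectation M (\<lambda>\<omega>'. sub_density_est T Y F k b n \<omega>' t))
                  / (1 - L t)\<bar>)
           (\<lambda>n. inverse (b n) * sqrt (ln (real n) / real n))"
proof -
  interpret prob_space M by fact
  interpret censored_neg_assoc M T Y F f G g
    by unfold_locales (use assms in auto)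
  have L: "L t = 1 - joint_survival t" for t
    using cdf_obs[of 1 t] assms(15)[of 1] by simp
  obtain c where c: "\<tau> < c" "L c < 1"
    using assms(22) unfolding upper_endpoint_def less_SUP_iff by auto
  \<comment> \<open>Needed only to know that \<open>{0<..\<tau>}\<close> is not empty.\<close>
  have "0 \<le> lower_endpoint F"
    unfolding lower_endpoint_def
  proof (rule cInf_greatest)
    have "\<forall>\<^sub>F x in at_top. 0 < F x"
    proof -
      interpret D: real_distribution "distr M borel (T 1)" by simp
      have "(F \<longlongrightarrow> 1) at_top" using D.cdf_lim_at_top_prob cdf_T[of 1] by simp
      then show ?thesis by (rule order_tendstoD) simp
    qed
    then show "{t. 0 < F t} \<noteq> {}" unfolding eventually_at_top_linorder by auto
    show "0 \<le> x" if "x \<in> {t. 0 < F t}" for x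
      using that cdf_negative(1)[of x] by (cases "x < 0") auto
  qed
  then have \<tau>: "0 < \<tau>" using assms(21) by simp
  have k: "k \<in> borel_measurable borel"
    using assms(16) by (auto simp: probability_kernel_def has_bochner_integral_iff)
  obtain K where K: "AE \<omega> in M. \<forall>\<^sub>F n in sequentially. \<forall>t\<le>\<tau>.
      \<bar>hazard_est T Y F k b n \<omega> t - smoothed_hazard f F k b n t
        - (sub_density_est T Y F k b n \<omega> t - expectation (\<lambda>\<omega>'. sub_density_est T Y F k b n \<omega>' t))
          / joint_survival t\<bar>
      \<le> K * (inverse (b n) * sqrt (ln (real n) / real n))"
    using kernel_error_rate[OF _ _ c(1) k assms(19,20,25,26)] c \<tau> L[of c] by auto
  show ?thesis
  proof (rule bigo_as_SUP)
    show "{0<..\<tau>} \<noteq> {}" using \<tau> by simp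
    show "\<forall>\<^sub>F n in sequentially. 0 < inverse (b n) * sqrt (ln (real n) / real n)"
      using eventually_ge_at_top[of 2] by eventually_elim (use assms(25) in simp)
    show "AE \<omega> in M. \<forall>\<^sub>F n in sequentially. \<forall>t\<in>{0<..\<tau>}.
        \<bar>hazard_est T Y F k b n \<omega> t - smoothed_hazard f F k b n t
          - (sub_density_est T Y F k b n \<omega> t - expectation (\<lambda>\<omega>'. sub_density_est T Y F k b n \<omega>' t))
            / (1 - L t)\<bar>
        \<le> K * (inverse (b n) * sqrt (ln (real n) / real n))"
      using K by eventually_elim (auto simp: L elim: eventually_mono)
  qed
qed

end
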